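(* Let $F\colon\mathbf{C}\to\mathbf{D}$ and $G\colon\mathbf{D}\to\mathbf{C}$ be functors with $F\dashv G$, and let $(\mathcal{E}_{\mathbf C},\mathcal{M}_{\mathbf C})$ and $(\mathcal{E}_{\mathbf D},\mathcal{M}_{\mathbf D})$ be orthogonal factorisation systems on $\mathbf{C}$ and $\mathbf{D}$. Assume: (A1) $\mathbf{C}$ and $\mathbf{D}$ are $\mathcal{M}$-well-powered (the $\mathcal{M}$-subobjects of each object, up to equivalence, form a set); (A2) $\mathbf{C}$ and $\mathbf{D}$ have all small limits; (A3) the diagonal $S\to S\times S$ is in $\mathcal{M}_{\mathbf C}$ for every $S\in\mathbf{C}$, and $X\to X\times X$ is in $\mathcal{M}_{\mathbf D}$ for every $X\in\mathbf{D}$; (A4) $\mathbf{D}$ has all small coproducts; (A5) in $\mathbf{D}$, coproducts distribute over pullbacks; (A6) in $\mathbf{D}$, if $e\colon Q\to R$ is in $\mathcal{E}_{\mathbf D}$ and $r=(r_1,r_2)\colon R\to X\times X$ is in $\mathcal{M}_{\mathbf D}$, then the canonical map $e\times_Xe\colon Q\times_X^{r_2e,\,r_1e}Q\to R\times_X^{r_2,r_1}R$ is in $\mathcal{E}_{\mathbf D}$; (A7) $F$ maps $\mathcal{M}_{\mathbf C}$ into $\mathcal{M}_{\mathbf D}$ and $G$ maps $\mathcal{M}_{\mathbf D}$ into $\mathcal{M}_{\mathbf C}$; (A8) for every $S\in\mathbf{C}$ the canonical map $\mu_S\colon F(S\times S)\to FS\times FS$ is in $\mathcal{M}_{\mathbf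 D}$. Then the assignments $\overline{F}(S,Q)=(FS,\widehat{FQ})$, $g\mapsto F(g)$ and $\overline{G}(X,R)=(GX,GR)$, $f\mapsto G(f)$ define functors $\overline{F}\colon\mathrm{Ord}(\mathbf{C})\to\mathrm{Ord}(\mathbf{D})$ and $\overline{G}\colon\mathrm{Ord}(\mathbf{D})\to\mathrm{Ord}(\mathbf{C})$, and $\overline{F}\dashv\overline{G}$.
   Context: Orthogonal factorisation system is the standard notion (both classes closed under composition, every arrow factors as an $\mathcal{E}$-arrow followed by an $\mathcal{M}$-arrow, unique diagonal fillers of $\mathcal{E}$ against $\mathcal{M}$; $\mathcal{E}\cap\mathcal{M}$ is the class of isomorphisms). An $\mathcal{M}$-subobject of $X$ is an arrow $A\to X$ in $\mathcal{M}$; $A\subseteq B$ means that $A\to X$ factors through $B\to X$; subobjects are considered up to the resulting equivalence, and $\mathcal{M}\mathrm{Sub}(X)$ denotes the poset of these. Under (A1) and (A2) it has all meets, computed as wide pullbacks. "Coproducts distribute over pullbacks" means that the canonical maps $\coprod_i(A_i\times_XB)\to(\coprod_iA_i)\times_XB$ (and symmetrically) are isomorphisms. An $\mathcal{M}$-relation from $X$ to $Y$ is an $\mathcal{M}$-subobject $r=(r_1,r_2)\colon R\to X\times Y$. The composite of $R$ (from $X$ to $Y$) and $Q$ (from $Y$ to $Z$), $q=(q_1,q_2)$, is the $\mathcal{M}$-relation $R\circ Q$ from $X$ to $Z$ given by the $\mathcal{M}$-part of the $(\mathcal{E},\mathcal{M})$-factorisation of $(r_1\circ\mathrm{pr}_1,q_2\circ\mathrm{pr}_2)\colon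 R\times_Y^{r_2,q_1}Q\to X\times Z$. An $\mathcal{M}$-relation $R$ on $X$ (from $X$ to $X$) is reflexive if the diagonal $\Delta_X\subseteq R$, transitive if $R\circ R\subseteq R$, and an $\mathcal{M}$-preorder if both. The transitive closure is $\widehat{R}=\bigwedge\{Q\in\mathcal{M}\mathrm{Sub}(X\times X):R\subseteq Q,\ Q\circ Q\subseteq Q\}$. $\mathrm{Ord}(\mathbf{D})$ has as objects pairs $(X,R)$ with $X\in\mathbf{D}$ and $R$ an $\mathcal{M}_{\mathbf D}$-preorder on $X$; morphisms $(X,R)\to(Y,Q)$ are arrows $f\colon X\to Y$ that are monotone, i.e. there exists $\overline{f}\colon R\to Q$ with $q\circ\overline{f}=(f\times f)\circ r$. Similarly $\mathrm{Ord}(\mathbf{C})$. $\mu_S$ is the unique map with $\mathrm{pr}_i\circ\mu_S=F(\mathrm{pr}_i)$. For $(S,Q)\in\mathrm{Ord}(\mathbf{C})$ with $q\colon Q\to S\times S$, $FQ$ denotes the $\mathcal{M}_{\mathbf D}$-relation $\mu_S\circ F(q)\colon FQ\to FS\times FS$ on $FS$, and $\widehat{FQ}$ its transitive closure. For $(X,R)\in\mathrm{Ord}(\mathbf{D})$ with $r\colon R\to X\times X$, $GR$ denotes the $\mathcal{M}_{\mathbf C}$-relation $GR\xrightarrow{G(r)}G(X\times X)\cong GX\times GX$. *)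

theory Defs
  imports "HOL-Library.Equipollence" "HOL-Library.Countable_Set"
begin

subsection \<open>Categories, functors, adjunctions\<close>

record ('o, 'a) cat =
  Ob :: "'o set"
  Ar :: "'a set"
  Dom :: "'a \<Rightarrow> 'o"
  Cod :: "'a \<Rightarrow> 'o"
  Id :: "'o \<Rightarrow> 'a"
  Comp :: "'a \<Rightarrow> 'a \<Rightarrow> 'a"  (infixl "\<cdot>\<index>" 70)

definition Hom :: "('o, 'a) cat \<Rightarrow> 'o \<Rightarrow> 'o \<Rightarrow> 'a set" where
  "Hom C X Y = {f \<in> Ar C. Dom C f = X \<and> Cod C f = Y}"

locale category =
  fixes C :: "('o, 'a) cat" (structure)
  assumes Dom_Ob: "f \<in> Ar C \<Longrightarrow> Dom C f \<in> Ob C"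
    and Cod_Ob: "f \<in> Ar C \<Longrightarrow> Cod C f \<in> Ob C"
    and Id_Hom: "X \<in> Ob C \<Longrightarrow> Id C X \<in> Hom C X X"
    and Comp_Hom: "f \<in> Hom C X Y \<Longrightarrow> g \<in> Hom C Y Z \<Longrightarrow> g \<cdot> f \<in> Hom C X Z"
    and Comp_Id: "f \<in> Hom C X Y \<Longrightarrow> f \<cdot> Id C X = f"
    and Id_Comp: "f \<in> Hom C X Y \<Longrightarrow> Id C Y \<cdot> f = f"
    and Comp_assoc: "f \<in> Hom C W X \<Longrightarrow> g \<in> Hom C X Y \<Longrightarrow> h \<in> Hom C Y Z
      \<Longrightarrow> (h \<cdot> g) \<cdot> f = h \<cdot> (g \<cdot> f)"

definition iso :: "('o, 'a) cat \<Rightarrow> 'a \<Rightarrow> bool" where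
  "iso C f \<longleftrightarrow> f \<in> Ar C \<and> (\<exists>g \<in> Hom C (Cod C f) (Dom C f).
     g \<cdot>\<^bsub>C\<^esub> f = Id C (Dom C f) \<and> f \<cdot>\<^bsub>C\<^esub> g = Id C (Cod C f))"

record ('o1, 'a1, 'o2, 'a2) funct =
  FOb :: "'o1 \<Rightarrow> 'o2"
  FAr :: "'a1 \<Rightarrow> 'a2"

definition is_functor ::
  "('o1, 'a1) cat \<Rightarrow> ('o2, 'a2) cat \<Rightarrow> ('o1, 'a1, 'o2, 'a2) funct \<Rightarrow> bool" where
  "is_functor C D F \<longleftrightarrow> category C \<and> category D \<and>
     (\<forall>X \<in> Ob C. FOb F X \<in> Ob D) \<and>
     (\<forall>X Y. \<forall>f \<in> Hom C X Y. FAr F f \<in> Hom D (FOb F X) (FOb F Y)) \<and>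
     (\<forall>X \<in> Ob C. FAr F (Id C X) = Id D (FOb F X)) \<and>
     (\<forall>X Y Z. \<forall>f \<in> Hom C X Y. \<forall>g \<in> Hom C Y Z.
        FAr F (g \<cdot>\<^bsub>C\<^esub> f) = FAr F g \<cdot>\<^bsub>D\<^esub> FAr F f)"

definition adjoint ::
  "('o1, 'a1) cat \<Rightarrow> ('o2, 'a2) cat \<Rightarrow> ('o1, 'a1, 'o2, 'a2) funct
    \<Rightarrow> ('o2, 'a2, 'o1, 'a1) funct \<Rightarrow> bool" where
  "adjoint C D F G \<longleftrightarrow> (\<exists>\<phi>.
     (\<forall>S \<in> Ob C. \<forall>X \<in> Ob D. bij_betw (\<phi> S X) (Hom D (FOb F S) X) (Hom C S (FOb G X))) \<and>
     (\<forall>S \<in> Ob C. \<forall>S' \<in> Ob C. \<forall>X \<in> Ob D. \<forall>X' \<in> Ob D.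
        \<forall>s \<in> Hom C S' S. \<forall>x \<in> Hom D X X'. \<forall>h \<in> Hom D (FOb F S) X.
          \<phi> S' X' (x \<cdot>\<^bsub>D\<^esub> h \<cdot>\<^bsub>D\<^esub> FAr F s) = FAr G x \<cdot>\<^bsub>C\<^esub> \<phi> S X h \<cdot>\<^bsub>C\<^esub> s))"


subsection \<open>Smallness, limits and coproducts\<close>

text \<open>Size is measured by a type \<open>'u\<close> playing the role of the universe: a set (of any type)
  is small if its cardinality is strictly below that of \<open>'u\<close>.  The classical notion is the
  case where \<open>'u\<close> has inaccessible cardinality.  A small index set or index
  category is then, up to bijection or isomorphism, one whose elements (objects, arrows) have
  type \<open>'u\<close>, so only these are quantified over below.\<close>

definition small :: "'u itself \<Rightarrow> 'b set \<Rightarrow> bool" where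
  "small U A \<longleftrightarrow> A \<prec> (UNIV :: 'u set)"

definition is_cone :: "('o, 'a) cat \<Rightarrow> ('i, 'j) cat \<Rightarrow> ('i, 'j, 'o, 'a) funct
    \<Rightarrow> 'o \<Rightarrow> ('i \<Rightarrow> 'a) \<Rightarrow> bool" where
  "is_cone C J T L \<pi> \<longleftrightarrow> L \<in> Ob C \<and> (\<forall>i \<in> Ob J. \<pi> i \<in> Hom C L (FOb T i)) \<and>
     (\<forall>u \<in> Ar J. FAr T u \<cdot>\<^bsub>C\<^esub> \<pi> (Dom J u) = \<pi> (Cod J u))"

definition is_limit :: "('o, 'a) cat \<Rightarrow> ('i, 'j) cat \<Rightarrow> ('i, 'j, 'o, 'a) funct
    \<Rightarrow> 'o \<Rightarrow> ('i \<Rightarrow> 'a) \<Rightarrow> bool" where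
  "is_limit C J T L \<pi> \<longleftrightarrow> is_cone C J T L \<pi> \<and>
     (\<forall>A \<alpha>. is_cone C J T A \<alpha> \<longrightarrow>
        (\<exists>!h. h \<in> Hom C A L \<and> (\<forall>i \<in> Ob J. \<pi> i \<cdot>\<^bsub>C\<^esub> h = \<alpha> i)))"

definition has_small_limits :: "'u itself \<Rightarrow> ('o, 'a) cat \<Rightarrow> bool" where
  "has_small_limits U C \<longleftrightarrow> (\<forall>(J :: ('u, 'u) cat) T.
     is_functor J C T \<and> small U (Ob J) \<and> small U (Ar J) \<longrightarrow> (\<exists>L \<pi>. is_limit C J T L \<pi>))"

definition is_coproduct ::
  "('o, 'a) cat \<Rightarrow> 'i set \<Rightarrow> ('i \<Rightarrow> 'o) \<Rightarrow> 'o \<Rightarrow> ('i \<Rightarrow> 'a) \<Rightarrow> bool" where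
  "is_coproduct C I A K \<iota> \<longleftrightarrow> K \<in> Ob C \<and>
     (\<forall>i \<in> I. A i \<in> Ob C \<and> \<iota> i \<in> Hom C (A i) K) \<and>
     (\<forall>Z \<in> Ob C. \<forall>f. (\<forall>i \<in> I. f i \<in> Hom C (A i) Z) \<longrightarrow>
        (\<exists>!h. h \<in> Hom C K Z \<and> (\<forall>i \<in> I. h \<cdot>\<^bsub>C\<^esub> \<iota> i = f i)))"

definition has_small_coproducts :: "'u itself \<Rightarrow> ('o, 'a) cat \<Rightarrow> bool" where
  "has_small_coproducts U C \<longleftrightarrow> (\<forall>(I :: 'u set) A.
     small U I \<and> (\<forall>i \<in> I. A i \<in> Ob C) \<longrightarrow> (\<exists>K \<iota>. is_coproduct C I A K \<iota>))"

definition is_pullback ::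
  "('o, 'a) cat \<Rightarrow> 'a \<Rightarrow> 'a \<Rightarrow> 'o \<Rightarrow> 'a \<Rightarrow> 'a \<Rightarrow> bool" where
  "is_pullback C f g P p1 p2 \<longleftrightarrow>
     f \<in> Ar C \<and> g \<in> Ar C \<and> Cod C f = Cod C g \<and>
     p1 \<in> Hom C P (Dom C f) \<and> p2 \<in> Hom C P (Dom C g) \<and> f \<cdot>\<^bsub>C\<^esub> p1 = g \<cdot>\<^bsub>C\<^esub> p2 \<and>
     (\<forall>A \<in> Ob C. \<forall>a \<in> Hom C A (Dom C f). \<forall>b \<in> Hom C A (Dom C g). f \<cdot>\<^bsub>C\<^esub> a = g \<cdot>\<^bsub>C\<^esub> b \<longrightarrow>
        (\<exists>!h. h \<in> Hom C A P \<and> p1 \<cdot>\<^bsub>C\<^esub> h = a \<and> p2 \<cdot>\<^bsub>C\<^esub> h = b))"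

text \<open>Below, \<open>u\<close> is the arrow \<open>[a\<^sub>i] : \<Coprod>A\<^sub>i \<rightarrow> X\<close> and \<open>h\<close> is the canonical map, characterised by
  its composites with the coproduct injections and the pullback projections.  The two clauses
  treat \<open>\<Coprod>(A\<^sub>i \<times>\<^sub>X B) \<rightarrow> (\<Coprod>A\<^sub>i) \<times>\<^sub>X B\<close> and \<open>\<Coprod>(B \<times>\<^sub>X A\<^sub>i) \<rightarrow> B \<times>\<^sub>X (\<Coprod>A\<^sub>i)\<close>.\<close>

definition coproducts_distribute_over_pullbacks :: "'u itself \<Rightarrow> ('o, 'a) cat \<Rightarrow> bool" where
  "coproducts_distribute_over_pullbacks U C \<longleftrightarrow>
     (\<forall>(I :: 'u set) X A B a b S \<iota> u P p1 p2 Q q1 q2 K \<kappa> h.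
        small U I \<and> X \<in> Ob C \<and> (\<forall>i \<in> I. a i \<in> Hom C (A i) X) \<and> b \<in> Hom C B X \<and>
        is_coproduct C I A S \<iota> \<and> u \<in> Hom C S X \<and> (\<forall>i \<in> I. u \<cdot>\<^bsub>C\<^esub> \<iota> i = a i) \<and>
        is_coproduct C I Q K \<kappa> \<and> h \<in> Hom C K P \<longrightarrow>
        (is_pullback C u b P p1 p2 \<and> (\<forall>i \<in> I. is_pullback C (a i) b (Q i) (q1 i) (q2 i)) \<and>
         (\<forall>i \<in> I. p1 \<cdot>\<^bsub>C\<^esub> h \<cdot>\<^bsub>C\<^esub> \<kappa> i = \<iota> i \<cdot>\<^bsub>C\<^esub> q1 i \<and> p2 \<cdot>\<^bsub>C\<^esub> h \<cdot>\<^bsub>C\<^esub> \<kappa> i = q2 i) \<longrightarrow> iso C h) \<and>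
        (is_pullback C b u P p1 p2 \<and> (\<forall>i \<in> I. is_pullback C b (a i) (Q i) (q1 i) (q2 i)) \<and>
         (\<forall>i \<in> I. p1 \<cdot>\<^bsub>C\<^esub> h \<cdot>\<^bsub>C\<^esub> \<kappa> i = q1 i \<and> p2 \<cdot>\<^bsub>C\<^esub> h \<cdot>\<^bsub>C\<^esub> \<kappa> i = \<iota> i \<cdot>\<^bsub>C\<^esub> q2 i) \<longrightarrow> iso C h))"


subsection \<open>Chosen binary products\<close>

definition is_product :: "('o, 'a) cat \<Rightarrow> 'o \<Rightarrow> 'o \<Rightarrow> 'o \<Rightarrow> 'a \<Rightarrow> 'a \<Rightarrow> bool" where
  "is_product C X Y P p1 p2 \<longleftrightarrow> P \<in> Ob C \<and> p1 \<in> Hom C P X \<and> p2 \<in> Hom C P Y \<and>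
     (\<forall>A \<in> Ob C. \<forall>a \<in> Hom C A X. \<forall>b \<in> Hom C A Y.
        \<exists>!h. h \<in> Hom C A P \<and> p1 \<cdot>\<^bsub>C\<^esub> h = a \<and> p2 \<cdot>\<^bsub>C\<^esub> h = b)"

definition product_choice :: "('o, 'a) cat \<Rightarrow> 'o \<Rightarrow> 'o \<Rightarrow> 'o \<times> 'a \<times> 'a" where
  "product_choice C X Y = (SOME (P, p1, p2). is_product C X Y P p1 p2)"

definition Prod :: "('o, 'a) cat \<Rightarrow> 'o \<Rightarrow> 'o \<Rightarrow> 'o" where
  "Prod C X Y = fst (product_choice C X Y)"

definition pr1 :: "('o, 'a) cat \<Rightarrow> 'o \<Rightarrow> 'o \<Rightarrow> 'a" where
  "pr1 C X Y = fst (snd (product_choice C X Y))"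

definition pr2 :: "('o, 'a) cat \<Rightarrow> 'o \<Rightarrow> 'o \<Rightarrow> 'a" where
  "pr2 C X Y = snd (snd (product_choice C X Y))"

definition tuple :: "('o, 'a) cat \<Rightarrow> 'a \<Rightarrow> 'a \<Rightarrow> 'a" where
  "tuple C f g = (THE h. h \<in> Hom C (Dom C f) (Prod C (Cod C f) (Cod C g)) \<and>
     pr1 C (Cod C f) (Cod C g) \<cdot>\<^bsub>C\<^esub> h = f \<and> pr2 C (Cod C f) (Cod C g) \<cdot>\<^bsub>C\<^esub> h = g)"

definition diagonal :: "('o, 'a) cat \<Rightarrow> 'o \<Rightarrow> 'a" where
  "diagonal C X = tuple C (Id C X) (Id C X)"

definition square :: "('o, 'a) cat \<Rightarrow> 'a \<Rightarrow> 'a" where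
  "square C f = tuple C (f \<cdot>\<^bsub>C\<^esub> pr1 C (Dom C f) (Dom C f)) (f \<cdot>\<^bsub>C\<^esub> pr2 C (Dom C f) (Dom C f))"

text \<open>The canonical comparison \<open>F (S \<times> S) \<rightarrow> F S \<times> F S\<close>: it is \<open>\<mu>\<^sub>S\<close> for the left adjoint, and
  the isomorphism \<open>G (X \<times> X) \<cong> G X \<times> G X\<close> for the right adjoint.\<close>

definition comparison ::
  "('o1, 'a1) cat \<Rightarrow> ('o2, 'a2) cat \<Rightarrow> ('o1, 'a1, 'o2, 'a2) funct \<Rightarrow> 'o1 \<Rightarrow> 'a2" where
  "comparison C D F S = tuple D (FAr F (pr1 C S S)) (FAr F (pr2 C S S))"


subsection \<open>Factorisation systems and subobjects\<close>

locale factorisation_system = category C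
  for C :: "('o, 'a) cat" (structure) +
  fixes E M :: "'a set"
  assumes E_Ar: "E \<subseteq> Ar C"
    and M_Ar: "M \<subseteq> Ar C"
    and E_comp: "e \<in> E \<Longrightarrow> e' \<in> E \<Longrightarrow> Cod C e = Dom C e' \<Longrightarrow> e' \<cdot> e \<in> E"
    and M_comp: "m \<in> M \<Longrightarrow> m' \<in> M \<Longrightarrow> Cod C m = Dom C m' \<Longrightarrow> m' \<cdot> m \<in> M"
    and E_Int_M: "E \<inter> M = {f. iso C f}"
    and factorisation: "f \<in> Ar C \<Longrightarrow> \<exists>e \<in> E. \<exists>m \<in> M. Cod C e = Dom C m \<and> f = m \<cdot> e"
    and diagonal_filler: "e \<in> E \<Longrightarrow> m \<in> M \<Longrightarrow> u \<in> Hom C (Dom C e) (Dom C m)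
      \<Longrightarrow> v \<in> Hom C (Cod C e) (Cod C m) \<Longrightarrow> m \<cdot> u = v \<cdot> e
      \<Longrightarrow> \<exists>!d. d \<in> Hom C (Cod C e) (Dom C m) \<and> d \<cdot> e = u \<and> m \<cdot> d = v"

text \<open>Arrows in \<open>M\<close> need not be monic, so two subobjects are identified when each factors through
  the other.\<close>

definition factors_through :: "('o, 'a) cat \<Rightarrow> 'a \<Rightarrow> 'a \<Rightarrow> bool" where
  "factors_through C a b \<longleftrightarrow> (\<exists>h \<in> Hom C (Dom C a) (Dom C b). b \<cdot>\<^bsub>C\<^esub> h = a)"

definition sub_class :: "('o, 'a) cat \<Rightarrow> 'a set \<Rightarrow> 'a \<Rightarrow> 'a set" where
  "sub_class C M m = {n \<in> M. Cod C n = Cod C m \<and> factors_through C m n \<and> factors_through C n m}"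

definition MSub :: "('o, 'a) cat \<Rightarrow> 'a set \<Rightarrow> 'o \<Rightarrow> 'a set set" where
  "MSub C M X = {sub_class C M m | m. m \<in> M \<and> Cod C m = X}"

definition sub_le :: "('o, 'a) cat \<Rightarrow> 'a set \<Rightarrow> 'a set \<Rightarrow> bool" where
  "sub_le C A B \<longleftrightarrow> (\<exists>a \<in> A. \<exists>b \<in> B. factors_through C a b)"

definition meet :: "('o, 'a) cat \<Rightarrow> 'a set \<Rightarrow> 'o \<Rightarrow> 'a set set \<Rightarrow> 'a set" where
  "meet C M X \<S> = (THE A. A \<in> MSub C M X \<and> (\<forall>B \<in> \<S>. sub_le C A B) \<and>
     (\<forall>A' \<in> MSub C M X. (\<forall>B \<in> \<S>. sub_le C A' B) \<longrightarrow> sub_le C A' A))"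

definition well_powered :: "'u itself \<Rightarrow> ('o, 'a) cat \<Rightarrow> 'a set \<Rightarrow> bool" where
  "well_powered U C M \<longleftrightarrow> (\<forall>X \<in> Ob C. small U (MSub C M X))"


subsection \<open>Relations and preorders\<close>

definition is_rel :: "('o, 'a) cat \<Rightarrow> 'a set \<Rightarrow> 'o \<Rightarrow> 'o \<Rightarrow> 'a \<Rightarrow> bool" where
  "is_rel C M X Y r \<longleftrightarrow> r \<in> M \<and> Cod C r = Prod C X Y"

text \<open>\<open>rel_comp C E M X Y Z r q\<close> is the composite \<open>R \<circ> Q\<close> from \<open>X\<close> to \<open>Z\<close> (first \<open>r\<close>, then \<open>q\<close>),
  which is determined up to isomorphism over \<open>X \<times> Z\<close>.\<close>

definition rel_comp ::
  "('o, 'a) cat \<Rightarrow> 'a set \<Rightarrow> 'a set \<Rightarrow> 'o \<Rightarrow> 'o \<Rightarrow> 'o \<Rightarrow> 'a \<Rightarrow> 'a \<Rightarrow> 'a" where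
  "rel_comp C E M X Y Z r q =
     (let (P, p1, p2) = (SOME (P, p1, p2).
            is_pullback C (pr2 C X Y \<cdot>\<^bsub>C\<^esub> r) (pr1 C Y Z \<cdot>\<^bsub>C\<^esub> q) P p1 p2);
          t = tuple C (pr1 C X Y \<cdot>\<^bsub>C\<^esub> r \<cdot>\<^bsub>C\<^esub> p1) (pr2 C Y Z \<cdot>\<^bsub>C\<^esub> q \<cdot>\<^bsub>C\<^esub> p2)
      in SOME m. m \<in> M \<and> (\<exists>e \<in> E. Cod C e = Dom C m \<and> m \<cdot>\<^bsub>C\<^esub> e = t))"

definition reflexive_rel :: "('o, 'a) cat \<Rightarrow> 'o \<Rightarrow> 'a \<Rightarrow> bool" where
  "reflexive_rel C X r \<longleftrightarrow> factors_through C (diagonal C X) r"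

definition transitive_rel :: "('o, 'a) cat \<Rightarrow> 'a set \<Rightarrow> 'a set \<Rightarrow> 'o \<Rightarrow> 'a \<Rightarrow> bool" where
  "transitive_rel C E M X r \<longleftrightarrow> factors_through C (rel_comp C E M X X X r r) r"

definition is_preorder :: "('o, 'a) cat \<Rightarrow> 'a set \<Rightarrow> 'a set \<Rightarrow> 'o \<Rightarrow> 'a \<Rightarrow> bool" where
  "is_preorder C E M X r \<longleftrightarrow>
     is_rel C M X X r \<and> reflexive_rel C X r \<and> transitive_rel C E M X r"

definition transitive_closure :: "('o, 'a) cat \<Rightarrow> 'a set \<Rightarrow> 'a set \<Rightarrow> 'o \<Rightarrow> 'a \<Rightarrow> 'a set" where
  "transitive_closure C E M X r = meet C M (Prod C X X)
     {sub_class C M q | q. is_rel C M X X q \<and> factors_through C r q \<and> transitive_rel C E M X q}"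


subsection \<open>The category of preorders\<close>

text \<open>The relation of an object is an element of \<open>MSub\<close>, i.e. an equivalence class of arrows in
  \<open>M\<close>.  An arrow carries its domain and codomain.  Being a preorder and monotonicity do not
  depend on the representatives.\<close>

type_synonym ('o, 'a) ord_ob = "'o \<times> 'a set"
type_synonym ('o, 'a) ord_ar = "('o, 'a) ord_ob \<times> 'a \<times> ('o, 'a) ord_ob"

definition ord_objects :: "('o, 'a) cat \<Rightarrow> 'a set \<Rightarrow> 'a set \<Rightarrow> ('o, 'a) ord_ob set" where
  "ord_objects C E M = {(X, sub_class C M r) | X r. X \<in> Ob C \<and> is_preorder C E M X r}"

definition monotone_arrow ::
  "('o, 'a) cat \<Rightarrow> ('o, 'a) ord_ob \<Rightarrow> 'a \<Rightarrow> ('o, 'a) ord_ob \<Rightarrow> bool" where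
  "monotone_arrow C P f Q \<longleftrightarrow> f \<in> Hom C (fst P) (fst Q) \<and>
     (\<exists>r \<in> snd P. \<exists>q \<in> snd Q. \<exists>f' \<in> Hom C (Dom C r) (Dom C q).
        q \<cdot>\<^bsub>C\<^esub> f' = square C f \<cdot>\<^bsub>C\<^esub> r)"

definition Ord ::
  "('o, 'a) cat \<Rightarrow> 'a set \<Rightarrow> 'a set \<Rightarrow> (('o, 'a) ord_ob, ('o, 'a) ord_ar) cat" where
  "Ord C E M = \<lparr>
     Ob = ord_objects C E M,
     Ar = {(P, f, Q). P \<in> ord_objects C E M \<and> Q \<in> ord_objects C E M \<and> monotone_arrow C P f Q},
     Dom = (\<lambda>(P, f, Q). P),
     Cod = (\<lambda>(P, f, Q). Q),
     Id = (\<lambda>P. (P, Id C (fst P), P)),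
     Comp = (\<lambda>(Q', g, R) (P, f, Q). (P, g \<cdot>\<^bsub>C\<^esub> f, R)) \<rparr>"

text \<open>The relations \<open>FQ\<close> on \<open>F S\<close> and \<open>GR\<close> on \<open>G X\<close> are both instances of \<open>image_rel\<close>.\<close>

definition image_rel :: "('o1, 'a1) cat \<Rightarrow> ('o2, 'a2) cat \<Rightarrow> ('o1, 'a1, 'o2, 'a2) funct
    \<Rightarrow> 'o1 \<Rightarrow> 'a1 \<Rightarrow> 'a2" where
  "image_rel C D F S q = comparison C D F S \<cdot>\<^bsub>D\<^esub> FAr F q"

text \<open>On objects, both functors pick a representative of the given class.\<close>

definition Ord_left_ob :: "('o1, 'a1) cat \<Rightarrow> ('o2, 'a2) cat \<Rightarrow> 'a2 set \<Rightarrow> 'a2 set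
    \<Rightarrow> ('o1, 'a1, 'o2, 'a2) funct \<Rightarrow> ('o1, 'a1) ord_ob \<Rightarrow> ('o2, 'a2) ord_ob" where
  "Ord_left_ob C D E M F = (\<lambda>(S, A).
     (FOb F S, transitive_closure D E M (FOb F S) (image_rel C D F S (SOME q. q \<in> A))))"

definition Ord_left :: "('o1, 'a1) cat \<Rightarrow> ('o2, 'a2) cat \<Rightarrow> 'a2 set \<Rightarrow> 'a2 set
    \<Rightarrow> ('o1, 'a1, 'o2, 'a2) funct
    \<Rightarrow> (('o1, 'a1) ord_ob, ('o1, 'a1) ord_ar, ('o2, 'a2) ord_ob, ('o2, 'a2) ord_ar) funct" where
  "Ord_left C D E M F = \<lparr>
     FOb = Ord_left_ob C D E M F,
     FAr = (\<lambda>(P, g, Q). (Ord_left_ob C D E M F P, FAr F g, Ord_left_ob C D E M F Q)) \<rparr>"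

definition Ord_right_ob :: "('o1, 'a1) cat \<Rightarrow> ('o2, 'a2) cat \<Rightarrow> 'a1 set
    \<Rightarrow> ('o2, 'a2, 'o1, 'a1) funct \<Rightarrow> ('o2, 'a2) ord_ob \<Rightarrow> ('o1, 'a1) ord_ob" where
  "Ord_right_ob C D M G = (\<lambda>(X, A).
     (FOb G X, sub_class C M (image_rel D C G X (SOME r. r \<in> A))))"

definition Ord_right :: "('o1, 'a1) cat \<Rightarrow> ('o2, 'a2) cat \<Rightarrow> 'a1 set
    \<Rightarrow> ('o2, 'a2, 'o1, 'a1) funct
    \<Rightarrow> (('o2, 'a2) ord_ob, ('o2, 'a2) ord_ar, ('o1, 'a1) ord_ob, ('o1, 'a1) ord_ar) funct" where
  "Ord_right C D M G = \<lparr>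
     FOb = Ord_right_ob C D M G,
     FAr = (\<lambda>(P, f, Q). (Ord_right_ob C D M G P, FAr G f, Ord_right_ob C D M G Q)) \<rparr>"


subsection \<open>Stability of \<open>E\<close> under self-pullback along relations\<close>

text \<open>In the definition below \<open>h\<close> is the canonical map \<open>e \<times>\<^sub>X e\<close>.\<close>

definition E_stable_over_relations :: "('o, 'a) cat \<Rightarrow> 'a set \<Rightarrow> 'a set \<Rightarrow> bool" where
  "E_stable_over_relations C E M \<longleftrightarrow>
     (\<forall>X \<in> Ob C. \<forall>e \<in> E. \<forall>r. is_rel C M X X r \<and> Dom C r = Cod C e \<longrightarrow>
        (let r1 = pr1 C X X \<cdot>\<^bsub>C\<^esub> r; r2 = pr2 C X X \<cdot>\<^bsub>C\<^esub> r in
         \<forall>P p1 p2 P' p1' p2' h.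
           is_pullback C (r2 \<cdot>\<^bsub>C\<^esub> e) (r1 \<cdot>\<^bsub>C\<^esub> e) P p1 p2 \<and> is_pullback C r2 r1 P' p1' p2' \<and>
           h \<in> Hom C P P' \<and> p1' \<cdot>\<^bsub>C\<^esub> h = e \<cdot>\<^bsub>C\<^esub> p1 \<and> p2' \<cdot>\<^bsub>C\<^esub> h = e \<cdot>\<^bsub>C\<^esub> p2 \<longrightarrow> h \<in> E))"

end

theory Submission
  imports Defs
begin

text \<open>Relations are handled through generalised elements: \<open>x, y : A \<rightarrow> X\<close> are related by \<open>R\<close> if
  \<open>(x, y) : A \<rightarrow> X \<times> X\<close> factors through \<open>R\<close>.  By orthogonality, \<open>R \<circ> R \<subseteq> R\<close> holds iff this is
  a transitive relation on the elements at each stage \<open>A\<close>, and by the Yoneda lemma an arrow is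
  monotone iff it preserves related elements.  Hence transitivity passes to inverse images and to
  meets, so the transitive closure is transitive.  Transposition along the adjunction identifies the
  elements of \<open>GX\<close> at stage \<open>S\<close> with those of \<open>X\<close> at stage \<open>FS\<close>, and relatedness by \<open>GR\<close> with
  relatedness by \<open>R\<close>.  An arrow \<open>h : FS \<rightarrow> X\<close> is therefore monotone on the closure of \<open>FQ\<close> iff its
  transpose is monotone on \<open>Q\<close>; functoriality on both sides follows from this through the unit
  and the counit.\<close>

subsection \<open>Small limits\<close>

text \<open>The two sides differ because of limits. As a right adjoint, \<open>G\<close> respects
  the products and pullbacks behind composable pairs, so \<open>GR\<close> inherits transitivity
  from \<open>R\<close>. \<open>F\<close> need not respect these pullbacks, so \<open>FQ\<close> may
  fail to be transitive; reflexivity survives because \<open>F\<close> respects identities, and the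
  closure supplies the rest. Arrows in \<open>M\<close> need not be monic, so a factorisation
  through a relation need not be unique. Relatedness therefore records only that a factorisation
  exists, and the arguments never compare two witnesses. The closure is a meet over a family of
  subobject classes whose type has nothing to do with \<open>'u\<close>. Well-poweredness bounds the
  size of this family, but limits are supplied only for index categories of type \<open>'u\<close>,
  so diagrams must first be relabelled. An uncountable \<open>'u\<close> makes every finite index
  set small, which covers products and pullbacks.\<close>

lemma small_lepoll: "small U A \<Longrightarrow> B \<lesssim> A \<Longrightarrow> small U B"
  unfolding small_def by (rule lesspoll_trans1)

lemma small_finite:
  assumes "uncountable (UNIV :: 'u set)" and "finite A"
  shows "small TYPE('u) A"
  unfolding small_def
  using assms countable_finite finite_lesspoll_infinite by blast

lemma small_Times:
  assumes "uncountable (UNIV :: 'u set)" and "small TYPE('u) A"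
  shows "small TYPE('u) (A \<times> A)"
proof (cases "finite A")
  case True
  then show ?thesis by (intro small_finite[OF assms(1)]) simp
next
  case False
  then have "A \<times> A \<lesssim> A"
    using card_of_Times_same_infinite[OF False] ordIso_imp_ordLeq card_of_ordLeq[of "A \<times> A" A]
    unfolding lepoll_def by blast
  then show ?thesis using assms(2) small_lepoll by blast
qed

text \<open>This is the index set of a multi-pullback diagram over a family indexed by
  \<open>A\<close>: one base point and two objects for each index.\<close>

lemma small_option_Times_bool:
  assumes "uncountable (UNIV :: 'u set)" and "small TYPE('u) A"
  shows "small TYPE('u) (insert None (Some ` (A \<times> (UNIV :: bool set))))"
proof (cases "finite A")
  case True
  then show ?thesis by (intro small_finite[OF assms(1)]) simp
next
  case False
  obtain a b c where abc: "a \<in> A" "b \<in> A" "c \<in> A" "a \<noteq> b" "a \<noteq> c" "b \<noteq> c"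
    using infinite_arbitrarily_large[OF False, of 3] by (auto simp: card_3_iff)
  \<comment> \<open>The second coordinate tags the kind of element: \<open>a\<close> marks
    \<open>None\<close>, while \<open>b\<close> and \<open>c\<close> mark the two booleans. Hence
    three distinct elements of \<open>A\<close> are picked.\<close>
  define f where "f z = (case z of None \<Rightarrow> (a, a) | Some (x, t) \<Rightarrow> (x, if t then b else c))" for z
  have "inj_on f (insert None (Some ` (A \<times> UNIV)))"
    using abc by (auto simp: inj_on_def f_def split: if_splits)
  moreover have "f ` insert None (Some ` (A \<times> UNIV)) \<subseteq> A \<times> A"
    using abc by (auto simp: f_def)
  ultimately have "insert None (Some ` (A \<times> (UNIV :: bool set))) \<lesssim> A \<times> A"
    unfolding lepoll_def by blast
  then show ?thesis using small_Times[OF assms] small_lepoll by blast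
qed

context category
begin

lemma HomI: "f \<in> Ar C \<Longrightarrow> f \<in> Hom C (Dom C f) (Cod C f)"
  by (simp add: Hom_def)

lemma Hom_Dom: "f \<in> Hom C X Y \<Longrightarrow> Dom C f = X"
  by (simp add: Hom_def)

lemma Hom_Cod: "f \<in> Hom C X Y \<Longrightarrow> Cod C f = Y"
  by (simp add: Hom_def)

lemma Hom_Ar: "f \<in> Hom C X Y \<Longrightarrow> f \<in> Ar C"
  by (simp add: Hom_def)

lemma Hom_Ob: "f \<in> Hom C X Y \<Longrightarrow> X \<in> Ob C" "f \<in> Hom C X Y \<Longrightarrow> Y \<in> Ob C"
  using Dom_Ob Cod_Ob by (auto simp: Hom_def)

end

section \<open>Limits over small diagrams of arbitrary index type\<close>

lemma is_functorD:
  assumes "is_functor J C T"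
  shows "category J" "category C"
    and "X \<in> Ob J \<Longrightarrow> FOb T X \<in> Ob C"
    and "f \<in> Hom J X Y \<Longrightarrow> FAr T f \<in> Hom C (FOb T X) (FOb T Y)"
    and "X \<in> Ob J \<Longrightarrow> FAr T (Id J X) = Id C (FOb T X)"
    and "f \<in> Hom J X Y \<Longrightarrow> g \<in> Hom J Y Z
      \<Longrightarrow> FAr T (g \<cdot>\<^bsub>J\<^esub> f) = FAr T g \<cdot>\<^bsub>C\<^esub> FAr T f"
  using assms unfolding is_functor_def by blast+

text \<open>\<open>has_small_limits\<close> quantifies only over index categories whose objects and
  arrows have type \<open>'u\<close>. A small category of other types is relabelled along injections
  into \<open>'u\<close>, and its limit cone is carried back.\<close>

lemma small_limit_exists:
  fixes J :: "('i, 'j) cat" and C :: "('o, 'a) cat"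
  assumes lim: "has_small_limits TYPE('u) C" and T: "is_functor J C T"
    and small: "small TYPE('u) (Ob J)" "small TYPE('u) (Ar J)"
  shows "\<exists>L \<pi>. is_limit C J T L \<pi>"
proof -
  obtain ob :: "'i \<Rightarrow> 'u" where ob: "inj_on ob (Ob J)"
    using small(1) unfolding small_def lesspoll_def lepoll_def by blast
  obtain ar :: "'j \<Rightarrow> 'u" where ar: "inj_on ar (Ar J)"
    using small(2) unfolding small_def lesspoll_def lepoll_def by blast
  define ob' where "ob' = inv_into (Ob J) ob"
  define ar' where "ar' = inv_into (Ar J) ar"
  have ob'[simp]: "ob' (ob x) = x" if "x \<in> Ob J" for x
    using that ob by (simp add: ob'_def)
  have ar'[simp]: "ar' (ar f) = f" if "f \<in> Ar J" for f
    using that ar by (simp add: ar'_def)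
  interpret J: category J by (rule is_functorD(1)[OF T])
  have ob_eq[simp]: "ob x = ob y \<longleftrightarrow> x = y" if "x \<in> Ob J" "y \<in> Ob J" for x y
    using that ob by (auto dest: inj_onD)
  \<comment> \<open>The image of \<open>J\<close> under the two injections. All structure is
    computed by decoding with \<open>ob'\<close> and \<open>ar'\<close>, whose values outside the
    images never matter.\<close>
  define K where "K = \<lparr>Ob = ob ` Ob J, Ar = ar ` Ar J,
    Dom = (\<lambda>u. ob (Dom J (ar' u))), Cod = (\<lambda>u. ob (Cod J (ar' u))),
    Id = (\<lambda>x. ar (Id J (ob' x))), Comp = (\<lambda>v u. ar (ar' v \<cdot>\<^bsub>J\<^esub> ar' u))\<rparr>"
  define T' where "T' = \<lparr>FOb = (\<lambda>x. FOb T (ob' x)), FAr = (\<lambda>u. FAr T (ar' u))\<rparr>"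
  have K_Hom: "\<exists>f x y. u = ar f \<and> X = ob x \<and> Y = ob y \<and> f \<in> Hom J x y \<and> f \<in> Ar J
      \<and> x \<in> Ob J \<and> y \<in> Ob J"
    if u: "u \<in> Hom K X Y" for u X Y
  proof -
    obtain f where f: "f \<in> Ar J" "u = ar f"
      using u by (auto simp: Hom_def K_def)
    then show ?thesis
      using u J.HomI[OF f(1)] J.Dom_Ob J.Cod_Ob by (auto simp: Hom_def K_def)
  qed
  have Hom_K: "ar f \<in> Hom K (ob x) (ob y)" if "f \<in> Hom J x y" for f x y
    using that by (auto simp: Hom_def K_def)
  have K_Id: "Id K (ob x) = ar (Id J x)" if "x \<in> Ob J" for x
    using that by (simp add: K_def)
  have K_Comp: "Comp K (ar g) (ar f) = ar (g \<cdot>\<^bsub>J\<^esub> f)" if "f \<in> Ar J" "g \<in> Ar J" for f g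
    using that by (simp add: K_def)
  have catK: "category K"
  proof
    show "Dom K u \<in> Ob K" if "u \<in> Ar K" for u
      using that J.Dom_Ob by (auto simp: K_def)
    show "Cod K u \<in> Ob K" if "u \<in> Ar K" for u
      using that J.Cod_Ob by (auto simp: K_def)
    show "Id K X \<in> Hom K X X" if "X \<in> Ob K" for X
      using that Hom_K[OF J.Id_Hom] K_Id by (auto simp: K_def)
    show "Comp K g f \<in> Hom K X Z" if fg: "f \<in> Hom K X Y" "g \<in> Hom K Y Z" for f g X Y Z
    proof -
      obtain f' x y where f: "f = ar f'" "X = ob x" "Y = ob y" "f' \<in> Hom J x y" "f' \<in> Ar J" "y \<in> Ob J"
        using K_Hom[OF fg(1)] by blast
      obtain g' z where g: "g = ar g'" "Z = ob z" "g' \<in> Hom J y z" "g' \<in> Ar J"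
        using K_Hom[OF fg(2)] f ob_eq by blast
      show ?thesis using f g K_Comp Hom_K[OF J.Comp_Hom[OF f(4) g(3)]] by simp
    qed
    show "Comp K f (Id K X) = f" if fK: "f \<in> Hom K X Y" for f X Y
    proof -
      obtain f' x y where f: "f = ar f'" "X = ob x" "f' \<in> Hom J x y" "f' \<in> Ar J" "x \<in> Ob J"
        using K_Hom[OF fK] by blast
      show ?thesis
        using f K_Id K_Comp J.Comp_Id[OF f(3)] J.Hom_Ar[OF J.Id_Hom[OF f(5)]] by simp
    qed
    show "Comp K (Id K Y) f = f" if fK: "f \<in> Hom K X Y" for f X Y
    proof -
      obtain f' x y where f: "f = ar f'" "Y = ob y" "f' \<in> Hom J x y" "f' \<in> Ar J" "y \<in> Ob J"
        using K_Hom[OF fK] by blast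
      show ?thesis
        using f K_Id K_Comp J.Id_Comp[OF f(3)] J.Hom_Ar[OF J.Id_Hom[OF f(5)]] by simp
    qed
    show "Comp K (Comp K h g) f = Comp K h (Comp K g f)"
      if fgh: "f \<in> Hom K W X" "g \<in> Hom K X Y" "h \<in> Hom K Y Z" for f g h W X Y Z
    proof -
      obtain f' w x where f: "f = ar f'" "X = ob x" "f' \<in> Hom J w x" "f' \<in> Ar J" "x \<in> Ob J"
        using K_Hom[OF fgh(1)] by blast
      obtain g' y where g: "g = ar g'" "Y = ob y" "g' \<in> Hom J x y" "g' \<in> Ar J" "y \<in> Ob J"
        using K_Hom[OF fgh(2)] f ob_eq by blast
      obtain h' z where h: "h = ar h'" "h' \<in> Hom J y z" "h' \<in> Ar J"
        using K_Hom[OF fgh(3)] g ob_eq by blast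
      show ?thesis
        using f g h J.Comp_assoc[OF f(3) g(3) h(2)] K_Comp
          J.Hom_Ar[OF J.Comp_Hom[OF f(3) g(3)]] J.Hom_Ar[OF J.Comp_Hom[OF g(3) h(2)]]
        by simp
    qed
  qed
  have T': "is_functor K C T'"
    unfolding is_functor_def
  proof (intro conjI allI ballI)
    show "category K" by fact
    show "category C" by (rule is_functorD(2)[OF T])
    show "FOb T' X \<in> Ob C" if "X \<in> Ob K" for X
      using that is_functorD(3)[OF T] by (auto simp: K_def T'_def)
    show "FAr T' u \<in> Hom C (FOb T' X) (FOb T' Y)" if "u \<in> Hom K X Y" for X Y u
      using K_Hom[OF that] is_functorD(4)[OF T] by (auto simp: T'_def)
    show "FAr T' (Id K X) = Id C (FOb T' X)" if "X \<in> Ob K" for X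
      using that is_functorD(5)[OF T] J.Hom_Ar[OF J.Id_Hom] by (auto simp: K_def T'_def)
    show "FAr T' (Comp K v u) = FAr T' v \<cdot>\<^bsub>C\<^esub> FAr T' u"
      if uv: "u \<in> Hom K X Y" "v \<in> Hom K Y Z" for X Y Z u v
    proof -
      obtain f x y where f: "u = ar f" "Y = ob y" "f \<in> Hom J x y" "f \<in> Ar J" "y \<in> Ob J"
        using K_Hom[OF uv(1)] by blast
      obtain g z where g: "v = ar g" "g \<in> Hom J y z" "g \<in> Ar J"
        using K_Hom[OF uv(2)] f ob_eq by blast
      show ?thesis
        using f g is_functorD(6)[OF T f(3) g(2)] J.Hom_Ar[OF J.Comp_Hom[OF f(3) g(2)]]
        by (simp add: K_Comp) (simp add: T'_def)
    qed
  qed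
  have "small TYPE('u) (Ob K)" "small TYPE('u) (Ar K)"
    using small by (auto simp: K_def intro: small_lepoll image_lepoll)
  then obtain L \<pi> where L: "is_limit C K T' L \<pi>"
    using lim catK T' unfolding has_small_limits_def by blast
  \<comment> \<open>Cones correspond under relabelling with the same apex, so the universal property
    is transported without changing the mediating arrows.\<close>
  have cone: "is_cone C K T' A \<alpha> \<longleftrightarrow> is_cone C J T A (\<alpha> \<circ> ob)" for A \<alpha>
    using J.Dom_Ob J.Cod_Ob by (simp add: is_cone_def K_def T'_def)
  have "is_limit C J T L (\<pi> \<circ> ob)"
    unfolding is_limit_def
  proof (intro conjI allI impI)
    show "is_cone C J T L (\<pi> \<circ> ob)" using L cone by (simp add: is_limit_def)
    fix A \<alpha> assume \<alpha>: "is_cone C J T A \<alpha>"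
    have "is_cone C K T' A (\<alpha> \<circ> ob')"
      unfolding cone using \<alpha> J.Dom_Ob J.Cod_Ob by (simp add: is_cone_def)
    then have "\<exists>!h. h \<in> Hom C A L \<and> (\<forall>i\<in>Ob K. \<pi> i \<cdot>\<^bsub>C\<^esub> h = (\<alpha> \<circ> ob') i)"
      using L unfolding is_limit_def by blast
    then show "\<exists>!h. h \<in> Hom C A L \<and> (\<forall>i\<in>Ob J. (\<pi> \<circ> ob) i \<cdot>\<^bsub>C\<^esub> h = \<alpha> i)"
      by (simp add: K_def)
  qed
  then show ?thesis by blast
qed

text \<open>A preorder seen as a category, with \<open>(x, y)\<close> as the only arrow from
  \<open>x\<close> to \<open>y\<close>. Parallel arrows of such a shape coincide, and every limit
  taken below has a shape of this kind.\<close>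

definition preorder_cat :: "'i set \<Rightarrow> ('i \<times> 'i) set \<Rightarrow> ('i, 'i \<times> 'i) cat" where
  "preorder_cat I \<rho> = \<lparr>Ob = I, Ar = \<rho>, Dom = fst, Cod = snd, Id = (\<lambda>x. (x, x)),
     Comp = (\<lambda>v u. (fst u, snd v))\<rparr>"

text \<open>Thinness lets a diagram be given as a bare family \<open>T1 x y\<close> and a cone by
  one equation per related pair. The arrows form a subset of \<open>I \<times> I\<close>, so
  smallness of \<open>I\<close> bounds them too.\<close>

lemma small_preorder_limit:
  fixes C :: "('o, 'a) cat" and I :: "'i set"
  assumes lim: "has_small_limits TYPE('u) C" and univ: "uncountable (UNIV :: 'u set)"
    and C: "category C" and I: "small TYPE('u) I"
    and \<rho>: "\<rho> \<subseteq> I \<times> I" "\<And>x. x \<in> I \<Longrightarrow> (x, x) \<in> \<rho>" "trans \<rho>"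
    and T0: "\<And>x. x \<in> I \<Longrightarrow> T0 x \<in> Ob C"
    and T1: "\<And>x y. (x, y) \<in> \<rho> \<Longrightarrow> T1 x y \<in> Hom C (T0 x) (T0 y)"
    and T1_Id: "\<And>x. x \<in> I \<Longrightarrow> T1 x x = Id C (T0 x)"
    and T1_Comp: "\<And>x y z. (x, y) \<in> \<rho> \<Longrightarrow> (y, z) \<in> \<rho> \<Longrightarrow> T1 x z = T1 y z \<cdot>\<^bsub>C\<^esub> T1 x y"
  obtains L \<pi> where "L \<in> Ob C" "\<And>x. x \<in> I \<Longrightarrow> \<pi> x \<in> Hom C L (T0 x)"
    "\<And>x y. (x, y) \<in> \<rho> \<Longrightarrow> T1 x y \<cdot>\<^bsub>C\<^esub> \<pi> x = \<pi> y"
    "\<And>A \<alpha>. A \<in> Ob C \<Longrightarrow> (\<And>x. x \<in> I \<Longrightarrow> \<alpha> x \<in> Hom C A (T0 x))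
       \<Longrightarrow> (\<And>x y. (x, y) \<in> \<rho> \<Longrightarrow> T1 x y \<cdot>\<^bsub>C\<^esub> \<alpha> x = \<alpha> y)
       \<Longrightarrow> \<exists>!h. h \<in> Hom C A L \<and> (\<forall>x \<in> I. \<pi> x \<cdot>\<^bsub>C\<^esub> h = \<alpha> x)"
proof -
  define J where "J = preorder_cat I \<rho>"
  define T where "T = \<lparr>FOb = T0, FAr = (\<lambda>u. T1 (fst u) (snd u))\<rparr>"
  note defs = J_def preorder_cat_def T_def
  have J: "category J"
    by unfold_locales (use \<rho> in \<open>auto simp: Hom_def defs dest: transD\<close>)
  have T: "is_functor J C T"
    unfolding is_functor_def
    using J C T0 T1 T1_Id T1_Comp by (auto simp: Hom_def defs)
  have "small TYPE('u) (Ar J)" "small TYPE('u) (Ob J)"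
    using small_lepoll[OF small_Times[OF univ I] subset_imp_lepoll[OF \<rho>(1)]] I
    by (simp_all add: defs)
  then obtain L \<pi> where L: "is_limit C J T L \<pi>"
    using small_limit_exists[OF lim T] by blast
  have cone: "is_cone C J T A \<alpha> \<longleftrightarrow> A \<in> Ob C \<and> (\<forall>x \<in> I. \<alpha> x \<in> Hom C A (T0 x)) \<and>
      (\<forall>x y. (x, y) \<in> \<rho> \<longrightarrow> T1 x y \<cdot>\<^bsub>C\<^esub> \<alpha> x = \<alpha> y)" for A \<alpha>
    by (auto simp: is_cone_def defs)
  have "Ob J = I" by (simp add: defs)
  then show thesis
    using that[of L \<pi>] L unfolding is_limit_def cone by simp
qed

lemma small_limits_product:
  fixes C :: "('o, 'a) cat" (structure)
  assumes lim: "has_small_limits TYPE('u) C" and univ: "uncountable (UNIV :: 'u set)"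
    and C: "category C" and XY: "X \<in> Ob C" "Y \<in> Ob C"
  shows "\<exists>P p1 p2. is_product C X Y P p1 p2"
proof -
  interpret category C by fact
  define T0 where "T0 t = (if t then X else Y)" for t
  have T0: "T0 t \<in> Ob C" for t using XY by (simp add: T0_def)
  have sm: "small TYPE('u) (UNIV :: bool set)" by (rule small_finite[OF univ]) simp
  obtain L \<pi> where L: "L \<in> Ob C" "\<And>x. \<pi> x \<in> Hom C L (T0 x)"
    and univL: "\<And>A \<alpha>. A \<in> Ob C \<Longrightarrow> (\<And>x. \<alpha> x \<in> Hom C A (T0 x))
       \<Longrightarrow> \<exists>!h. h \<in> Hom C A L \<and> (\<forall>x. \<pi> x \<cdot> h = \<alpha> x)"
  proof (rule small_preorder_limit[OF lim univ C sm, of "{(x, x) | x. True}" T0 "\<lambda>x y. Id C (T0 x)"])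
    fix L \<pi>
    assume L: "L \<in> Ob C" "\<And>x. x \<in> UNIV \<Longrightarrow> \<pi> x \<in> Hom C L (T0 x)"
      and u: "\<And>A \<alpha>. A \<in> Ob C \<Longrightarrow> (\<And>x. x \<in> UNIV \<Longrightarrow> \<alpha> x \<in> Hom C A (T0 x))
       \<Longrightarrow> (\<And>x y. (x, y) \<in> {(x, x) | x. True} \<Longrightarrow> Id C (T0 x) \<cdot> \<alpha> x = \<alpha> y)
       \<Longrightarrow> \<exists>!h. h \<in> Hom C A L \<and> (\<forall>x \<in> UNIV. \<pi> x \<cdot> h = \<alpha> x)"
    have "\<exists>!h. h \<in> Hom C A L \<and> (\<forall>x. \<pi> x \<cdot> h = \<alpha> x)"
      if "A \<in> Ob C" "\<And>x. \<alpha> x \<in> Hom C A (T0 x)" for A \<alpha>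
      using u[OF that(1) that(2)] Id_Comp[OF that(2)] by auto
    then show thesis using that L by blast
  qed (use T0 Id_Hom Id_Comp[OF Id_Hom[OF T0]] in \<open>auto simp: trans_def\<close>)
  have "is_product C X Y L (\<pi> True) (\<pi> False)"
    unfolding is_product_def
  proof (intro conjI ballI)
    show "L \<in> Ob C" "\<pi> True \<in> Hom C L X" "\<pi> False \<in> Hom C L Y"
      using L(1) L(2)[of True] L(2)[of False] by (auto simp: T0_def)
    fix A a b assume "A \<in> Ob C" "a \<in> Hom C A X" "b \<in> Hom C A Y"
    then have "\<exists>!h. h \<in> Hom C A L \<and> (\<forall>x. \<pi> x \<cdot> h = (if x then a else b))"
      by (intro univL) (auto simp: T0_def)
    moreover have "(\<forall>x. \<pi> x \<cdot> h = (if x then a else b)) \<longleftrightarrow> \<pi> True \<cdot> h = a \<and> \<pi> False \<cdot> h = b" for h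
      by (auto simp: all_bool_eq)
    ultimately show "\<exists>!h. h \<in> Hom C A L \<and> \<pi> True \<cdot> h = a \<and> \<pi> False \<cdot> h = b"
      by simp
  qed
  then show ?thesis by blast
qed

text \<open>With \<open>t\<close> constantly an identity this is a wide pullback, and with \<open>I\<close> a singleton it is an
  ordinary pullback.\<close>

lemma small_limits_multi_pullback:
  fixes C :: "('o, 'a) cat" (structure) and I :: "'i set"
  assumes lim: "has_small_limits TYPE('u) C" and univ: "uncountable (UNIV :: 'u set)"
    and C: "category C" and I: "small TYPE('u) I" and X: "X \<in> Ob C"
    and t: "\<And>i. i \<in> I \<Longrightarrow> t i \<in> Hom C X (Y i)"
    and m: "\<And>i. i \<in> I \<Longrightarrow> m i \<in> Hom C (A i) (Y i)"
  obtains L p \<pi> where "p \<in> Hom C L X" "\<And>i. i \<in> I \<Longrightarrow> \<pi> i \<in> Hom C L (A i)"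
    "\<And>i. i \<in> I \<Longrightarrow> t i \<cdot> p = m i \<cdot> \<pi> i"
    "\<And>B b \<beta>. b \<in> Hom C B X \<Longrightarrow> (\<And>i. i \<in> I \<Longrightarrow> \<beta> i \<in> Hom C B (A i))
       \<Longrightarrow> (\<And>i. i \<in> I \<Longrightarrow> t i \<cdot> b = m i \<cdot> \<beta> i)
       \<Longrightarrow> \<exists>!h. h \<in> Hom C B L \<and> p \<cdot> h = b \<and> (\<forall>i \<in> I. \<pi> i \<cdot> h = \<beta> i)"
proof -
  interpret category C by fact
  \<comment> \<open>\<open>None\<close> stands for \<open>X\<close>, \<open>Some (i, True)\<close>
    for \<open>A i\<close> and \<open>Some (i, False)\<close> for \<open>Y i\<close>. Every arrow
    other than an identity ends at some \<open>Y i\<close> and none starts there, so no two of them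
    compose.\<close>
  define K where "K = insert None (Some ` (I \<times> (UNIV :: bool set)))"
  define \<rho> where "\<rho> = {(x, y). x \<in> K \<and> y \<in> K \<and> (x = y \<or> (\<exists>i. y = Some (i, False) \<and> (x = None \<or> x = Some (i, True))))}"
  define T0 where "T0 x = (case x of None \<Rightarrow> X | Some (i, s) \<Rightarrow> if s then A i else Y i)" for x
  \<comment> \<open>\<open>undefined\<close> is never reached on \<open>\<rho>\<close>: the only
    pair of \<open>\<rho>\<close> ending in \<open>None\<close> is the identity.\<close>
  define T1 where "T1 x y = (if x = y then Id C (T0 x) else
    (case y of Some (i, s) \<Rightarrow> (case x of None \<Rightarrow> t i | _ \<Rightarrow> m i) | None \<Rightarrow> undefined))" for x y
  have K: "small TYPE('u) K" unfolding K_def by (rule small_option_Times_bool[OF univ I])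
  have K_cases: "x = None \<or> (\<exists>i \<in> I. x = Some (i, True)) \<or> (\<exists>i \<in> I. x = Some (i, False))" if "x \<in> K" for x
    using that by (auto simp: K_def)
  have T0: "T0 x \<in> Ob C" if "x \<in> K" for x
    using K_cases[OF that] X Hom_Ob(2)[OF t] Hom_Ob(1)[OF m] by (auto simp: T0_def)
  have T1: "T1 x y \<in> Hom C (T0 x) (T0 y)" if "(x, y) \<in> \<rho>" for x y
    using that t m Id_Hom[OF T0] by (auto simp: \<rho>_def T1_def) (auto simp: T0_def K_def)
  have T1_Comp: "T1 x z = T1 y z \<cdot> T1 x y" if "(x, y) \<in> \<rho>" "(y, z) \<in> \<rho>" for x y z
  proof (cases "x = y")
    case True
    then show ?thesis using Comp_Id[OF T1[OF that(2)]] by (simp add: T1_def)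
  next
    case False
    then have "y = z" using that by (auto simp: \<rho>_def)
    then show ?thesis using Id_Comp[OF T1[OF that(1)]] by (simp add: T1_def)
  qed
  have \<rho>: "\<rho> \<subseteq> K \<times> K" "\<And>x. x \<in> K \<Longrightarrow> (x, x) \<in> \<rho>" "trans \<rho>"
    by (auto simp: \<rho>_def trans_def)
  have T1_Id: "T1 x x = Id C (T0 x)" for x by (simp add: T1_def)
  obtain L \<pi> where L: "L \<in> Ob C" "\<And>x. x \<in> K \<Longrightarrow> \<pi> x \<in> Hom C L (T0 x)"
    "\<And>x y. (x, y) \<in> \<rho> \<Longrightarrow> T1 x y \<cdot> \<pi> x = \<pi> y"
    and univL: "\<And>A \<alpha>. A \<in> Ob C \<Longrightarrow> (\<And>x. x \<in> K \<Longrightarrow> \<alpha> x \<in> Hom C A (T0 x))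
       \<Longrightarrow> (\<And>x y. (x, y) \<in> \<rho> \<Longrightarrow> T1 x y \<cdot> \<alpha> x = \<alpha> y)
       \<Longrightarrow> \<exists>!h. h \<in> Hom C A L \<and> (\<forall>x \<in> K. \<pi> x \<cdot> h = \<alpha> x)"
    by (rule small_preorder_limit[OF lim univ C K \<rho> T0 T1 T1_Id T1_Comp]) blast+
  have inK: "None \<in> K" "\<And>i s. i \<in> I \<Longrightarrow> Some (i, s) \<in> K" by (auto simp: K_def)
  have in\<rho>: "(None, Some (i, False)) \<in> \<rho>" "(Some (i, True), Some (i, False)) \<in> \<rho>" if "i \<in> I" for i
    using inK that by (auto simp: \<rho>_def)
  have \<pi>F: "t i \<cdot> \<pi> None = \<pi> (Some (i, False))" "m i \<cdot> \<pi> (Some (i, True)) = \<pi> (Some (i, False))"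
    if "i \<in> I" for i
    using L(3)[OF in\<rho>(1)[OF that]] L(3)[OF in\<rho>(2)[OF that]] by (simp_all add: T1_def)
  show thesis
  proof
    show p: "\<pi> None \<in> Hom C L X" using L(2)[OF inK(1)] by (simp add: T0_def)
    show q: "\<pi> (Some (i, True)) \<in> Hom C L (A i)" if "i \<in> I" for i
      using L(2)[OF inK(2)[OF that, of True]] by (simp add: T0_def)
    show "t i \<cdot> \<pi> None = m i \<cdot> \<pi> (Some (i, True))" if "i \<in> I" for i
      using \<pi>F[OF that] by simp
    fix B b \<beta>
    assume b: "b \<in> Hom C B X" and \<beta>: "\<And>i. i \<in> I \<Longrightarrow> \<beta> i \<in> Hom C B (A i)"
      and comm: "\<And>i. i \<in> I \<Longrightarrow> t i \<cdot> b = m i \<cdot> \<beta> i"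
    \<comment> \<open>The leg to \<open>Y i\<close> is forced to be \<open>t i \<cdot> b\<close>, so
      a cone amounts to \<open>b\<close> together with the arrows \<open>\<beta> i\<close>.\<close>
    define \<alpha> where "\<alpha> x = (case x of None \<Rightarrow> b | Some (i, s) \<Rightarrow> if s then \<beta> i else t i \<cdot> b)" for x
    have \<alpha>: "\<alpha> x \<in> Hom C B (T0 x)" if "x \<in> K" for x
      using K_cases[OF that] b \<beta> Comp_Hom[OF b t] by (auto simp: T0_def \<alpha>_def)
    have "\<exists>!h. h \<in> Hom C B L \<and> (\<forall>x \<in> K. \<pi> x \<cdot> h = \<alpha> x)"
    proof (rule univL)
      show "B \<in> Ob C" by (rule Hom_Ob[OF b])
      show "\<alpha> x \<in> Hom C B (T0 x)" if "x \<in> K" for x using that by (rule \<alpha>)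
      show "T1 x y \<cdot> \<alpha> x = \<alpha> y" if "(x, y) \<in> \<rho>" for x y
      proof (cases "x = y")
        case True
        have "x \<in> K" using that by (simp add: \<rho>_def)
        then show ?thesis using True Id_Comp[OF \<alpha>] by (simp add: T1_def)
      next
        case False
        then show ?thesis using that comm by (auto simp: \<rho>_def T1_def \<alpha>_def K_def)
      qed
    qed
    moreover have "h \<in> Hom C B L \<and> (\<forall>x \<in> K. \<pi> x \<cdot> h = \<alpha> x) \<longleftrightarrow>
      h \<in> Hom C B L \<and> \<pi> None \<cdot> h = b \<and> (\<forall>i \<in> I. \<pi> (Some (i, True)) \<cdot> h = \<beta> i)" for h
    proof (rule conj_cong[OF refl])
      assume h: "h \<in> Hom C B L"
      have "\<pi> (Some (i, False)) \<cdot> h = t i \<cdot> (\<pi> None \<cdot> h)" if "i \<in> I" for i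
        using Comp_assoc[OF h p t[OF that]] \<pi>F(1)[OF that] by simp
      then show "(\<forall>x \<in> K. \<pi> x \<cdot> h = \<alpha> x) \<longleftrightarrow>
          \<pi> None \<cdot> h = b \<and> (\<forall>i \<in> I. \<pi> (Some (i, True)) \<cdot> h = \<beta> i)"
        by (auto simp: K_def \<alpha>_def)
    qed
    ultimately show "\<exists>!h. h \<in> Hom C B L \<and> \<pi> None \<cdot> h = b \<and> (\<forall>i \<in> I. \<pi> (Some (i, True)) \<cdot> h = \<beta> i)"
      by (simp only:)
  qed
qed

lemma small_limits_pullback:
  fixes C :: "('o, 'a) cat" (structure)
  assumes lim: "has_small_limits TYPE('u) C" and univ: "uncountable (UNIV :: 'u set)"
    and C: "category C" and fg: "f \<in> Hom C X Z" "g \<in> Hom C Y Z"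
  shows "\<exists>P p1 p2. is_pullback C f g P p1 p2"
proof -
  interpret category C by fact
  have sm: "small TYPE('u) (UNIV :: unit set)" by (rule small_finite[OF univ]) simp
  obtain L p \<pi> where L: "p \<in> Hom C L X" "\<And>i :: unit. \<pi> i \<in> Hom C L Y" "\<And>i. f \<cdot> p = g \<cdot> \<pi> i"
    and univL: "\<And>B b \<beta>. b \<in> Hom C B X \<Longrightarrow> (\<And>i. \<beta> i \<in> Hom C B Y)
       \<Longrightarrow> (\<And>i. f \<cdot> b = g \<cdot> \<beta> i)
       \<Longrightarrow> \<exists>!h. h \<in> Hom C B L \<and> p \<cdot> h = b \<and> (\<forall>i. \<pi> i \<cdot> h = \<beta> i)"
    by (rule small_limits_multi_pullback[OF lim univ C sm Hom_Ob(1)[OF fg(1)],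
        of "\<lambda>_. f" "\<lambda>_. Z" "\<lambda>_. g" "\<lambda>_. Y"]) (use fg in auto)
  have dc: "Dom C f = X" "Dom C g = Y" "Cod C f = Z" "Cod C g = Z"
    using fg by (auto simp: Hom_def)
  have "is_pullback C f g L p (\<pi> ())"
    unfolding is_pullback_def dc
  proof (intro conjI ballI impI)
    show "f \<in> Ar C" "g \<in> Ar C" using fg by (auto simp: Hom_def)
    show "p \<in> Hom C L X" "\<pi> () \<in> Hom C L Y" "f \<cdot> p = g \<cdot> \<pi> ()" using L by blast+
    fix A a b assume "A \<in> Ob C" "a \<in> Hom C A X" "b \<in> Hom C A Y" "f \<cdot> a = g \<cdot> b"
    then show "\<exists>!h. h \<in> Hom C A L \<and> p \<cdot> h = a \<and> \<pi> () \<cdot> h = b"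
      using univL[of a A "\<lambda>_. b"] by simp
  qed simp
  then show ?thesis by blast
qed


subsection \<open>Factorisation systems\<close>

context category
begin

lemma Id_Ar [simp]: "X \<in> Ob C \<Longrightarrow> Id C X \<in> Ar C"
  and Dom_Id [simp]: "X \<in> Ob C \<Longrightarrow> Dom C (Id C X) = X"
  and Cod_Id [simp]: "X \<in> Ob C \<Longrightarrow> Cod C (Id C X) = X"
  using Id_Hom by (auto simp: Hom_def)

lemma Comp_Ar [simp]: "f \<in> Ar C \<Longrightarrow> g \<in> Ar C \<Longrightarrow> Cod C f = Dom C g \<Longrightarrow> g \<cdot> f \<in> Ar C"
  and Dom_Comp [simp]: "f \<in> Ar C \<Longrightarrow> g \<in> Ar C \<Longrightarrow> Cod C f = Dom C g \<Longrightarrow> Dom C (g \<cdot> f) = Dom C f"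
  and Cod_Comp [simp]: "f \<in> Ar C \<Longrightarrow> g \<in> Ar C \<Longrightarrow> Cod C f = Dom C g \<Longrightarrow> Cod C (g \<cdot> f) = Cod C g"
  using Comp_Hom[OF HomI, of f g "Cod C g"] by (auto simp: Hom_def)

lemma Comp_Id_Ar [simp]: "f \<in> Ar C \<Longrightarrow> Dom C f = X \<Longrightarrow> f \<cdot> Id C X = f"
  using Comp_Id[OF HomI] by auto

lemma Id_Comp_Ar [simp]: "f \<in> Ar C \<Longrightarrow> Cod C f = X \<Longrightarrow> Id C X \<cdot> f = f"
  using Id_Comp[OF HomI] by auto

lemma Comp_assoc_Ar [simp]:
  "f \<in> Ar C \<Longrightarrow> g \<in> Ar C \<Longrightarrow> h \<in> Ar C \<Longrightarrow> Cod C f = Dom C g \<Longrightarrow> Cod C g = Dom C h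
    \<Longrightarrow> (h \<cdot> g) \<cdot> f = h \<cdot> (g \<cdot> f)"
  using Comp_assoc[of f "Dom C f" "Dom C g" g "Dom C h" h "Cod C h"] by (simp add: Hom_def)

declare Dom_Ob [simp] Cod_Ob [simp]

lemma isoI:
  assumes "f \<in> Hom C X Y" "g \<in> Hom C Y X" "g \<cdot> f = Id C X" "f \<cdot> g = Id C Y"
  shows "iso C f"
proof -
  have "Dom C f = X" "Cod C f = Y" "f \<in> Ar C" using assms(1) by (auto simp: Hom_def)
  then show ?thesis unfolding iso_def using assms(2-4) by auto
qed

lemma factors_through_refl: "a \<in> Ar C \<Longrightarrow> factors_through C a a"
  unfolding factors_through_def by (rule bexI[of _ "Id C (Dom C a)"]) (auto simp: Hom_def)

lemma factors_through_trans:
  assumes "factors_through C a b" "factors_through C b c" "c \<in> Ar C"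
  shows "factors_through C a c"
proof -
  obtain h where h: "h \<in> Hom C (Dom C a) (Dom C b)" "b \<cdot> h = a"
    using assms(1) unfolding factors_through_def by blast
  obtain k where k: "k \<in> Hom C (Dom C b) (Dom C c)" "c \<cdot> k = b"
    using assms(2) unfolding factors_through_def by blast
  have "c \<cdot> (k \<cdot> h) = a"
    using Comp_assoc[OF h(1) k(1) HomI[OF assms(3)]] h k by simp
  then show ?thesis
    unfolding factors_through_def using Comp_Hom[OF h(1) k(1)] by blast
qed

lemma factors_through_Comp:
  assumes "factors_through C a b" "b \<in> Ar C" "h \<in> Ar C" "Cod C h = Dom C a"
  shows "factors_through C (a \<cdot> h) b"
proof -
  obtain k where k: "k \<in> Hom C (Dom C a) (Dom C b)" "b \<cdot> k = a"
    using assms(1) unfolding factors_through_def by blast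
  have a: "a \<in> Ar C" using Hom_Ar[OF Comp_Hom[OF k(1) HomI[OF assms(2)]]] k(2) by simp
  have h: "h \<in> Hom C (Dom C h) (Dom C a)" using assms(3,4) by (simp add: Hom_def)
  have "b \<cdot> (k \<cdot> h) = a \<cdot> h"
    using Comp_assoc[OF h k(1) HomI[OF assms(2)]] k(2) by simp
  moreover have "Dom C (a \<cdot> h) = Dom C h" by (rule Dom_Comp[OF assms(3) a assms(4)])
  ultimately show ?thesis unfolding factors_through_def using Comp_Hom[OF h k(1)] by auto
qed

end

context factorisation_system
begin

lemma M_in_Ar [simp]: "m \<in> M \<Longrightarrow> m \<in> Ar C"
  using M_Ar by blast

lemma E_in_Ar [simp]: "e \<in> E \<Longrightarrow> e \<in> Ar C"
  using E_Ar by blast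

text \<open>Factor \<open>f = m \<cdot> e\<close> and lift the square from \<open>e\<close> to
  \<open>f\<close> whose top side is the identity; the lift \<open>d\<close> satisfies
  \<open>d \<cdot> e = Id C X\<close>. Both \<open>e \<cdot> d\<close> and the identity fill the
  square from \<open>e\<close> to \<open>m\<close>, so uniqueness of fillers makes \<open>e\<close>
  an isomorphism, hence a member of \<open>M\<close>. Existence of lifts against \<open>f\<close>
  suffices, the uniqueness being that of fillers against \<open>m\<close>.\<close>

lemma M_if_right_orthogonal:
  assumes f: "f \<in> Hom C X Y"
    and orth: "\<And>e u v. e \<in> E \<Longrightarrow> u \<in> Hom C (Dom C e) X \<Longrightarrow> v \<in> Hom C (Cod C e) Y \<Longrightarrow> f \<cdot> u = v \<cdot> e
      \<Longrightarrow> \<exists>d \<in> Hom C (Cod C e) X. d \<cdot> e = u \<and> f \<cdot> d = v"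
  shows "f \<in> M"
proof -
  obtain e m where e: "e \<in> E" and m: "m \<in> M" and em: "Cod C e = Dom C m" "f = m \<cdot> e"
    using factorisation[OF Hom_Ar[OF f]] by blast
  have dc: "Dom C e = X" "Cod C m = Y" "X \<in> Ob C"
    using f e m em Hom_Ob[OF f] by (auto simp: Hom_def)
  obtain d where d: "d \<in> Hom C (Cod C e) X" "d \<cdot> e = Id C X" "f \<cdot> d = m"
    using orth[OF e, of "Id C X" m] e m em f dc by (auto simp: Hom_def)
  have "\<exists>!x. x \<in> Hom C (Cod C e) (Dom C m) \<and> x \<cdot> e = e \<and> m \<cdot> x = m"
    by (rule diagonal_filler[OF e m]) (use e m em in \<open>auto simp: Hom_def\<close>)
  moreover have "e \<cdot> d \<in> Hom C (Cod C e) (Dom C m)" "(e \<cdot> d) \<cdot> e = e" "m \<cdot> (e \<cdot> d) = m"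
    using d e m em dc Comp_assoc_Ar[of d e m] by (auto simp: Hom_def)
  moreover have "Id C (Cod C e) \<in> Hom C (Cod C e) (Dom C m)" "Id C (Cod C e) \<cdot> e = e"
    "m \<cdot> Id C (Cod C e) = m"
    using e m em by (auto simp: Hom_def)
  ultimately have "e \<cdot> d = Id C (Cod C e)" by blast
  then have "iso C e"
    by (intro isoI[of e X "Cod C e" d]) (use e d dc in \<open>auto simp: Hom_def\<close>)
  then have "e \<in> M" using E_Int_M by blast
  then show ?thesis using M_comp[OF _ m em(1)] em(2) by simp
qed

text \<open>Lifting is componentwise: the square against \<open>p\<close> is filled against each
  \<open>m i\<close>, and the universal property assembles these fillers into one arrow.\<close>

lemma multi_pullback_M:
  assumes t: "\<And>i. i \<in> I \<Longrightarrow> t i \<in> Hom C X (Y i)"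
    and m: "\<And>i. i \<in> I \<Longrightarrow> m i \<in> Hom C (A i) (Y i)" "\<And>i. i \<in> I \<Longrightarrow> m i \<in> M"
    and p: "p \<in> Hom C L X" and \<pi>: "\<And>i. i \<in> I \<Longrightarrow> \<pi> i \<in> Hom C L (A i)"
    and comm: "\<And>i. i \<in> I \<Longrightarrow> t i \<cdot> p = m i \<cdot> \<pi> i"
    and univ: "\<And>B b \<beta>. b \<in> Hom C B X \<Longrightarrow> (\<And>i. i \<in> I \<Longrightarrow> \<beta> i \<in> Hom C B (A i))
       \<Longrightarrow> (\<And>i. i \<in> I \<Longrightarrow> t i \<cdot> b = m i \<cdot> \<beta> i)
       \<Longrightarrow> \<exists>!h. h \<in> Hom C B L \<and> p \<cdot> h = b \<and> (\<forall>i \<in> I. \<pi> i \<cdot> h = \<beta> i)"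
  shows "p \<in> M"
proof (rule M_if_right_orthogonal[OF p])
  fix e u v
  assume e: "e \<in> E" and u: "u \<in> Hom C (Dom C e) L" and v: "v \<in> Hom C (Cod C e) X"
    and puv: "p \<cdot> u = v \<cdot> e"
  have eH: "e \<in> Hom C (Dom C e) (Cod C e)" using HomI[OF E_in_Ar[OF e]] .
  have "\<exists>d. d \<in> Hom C (Cod C e) (A i) \<and> d \<cdot> e = \<pi> i \<cdot> u \<and> m i \<cdot> d = t i \<cdot> v" if i: "i \<in> I" for i
  proof -
    have "m i \<cdot> (\<pi> i \<cdot> u) = (t i \<cdot> v) \<cdot> e"
      using Comp_assoc[OF u \<pi>[OF i] m(1)[OF i]] Comp_assoc[OF u p t[OF i]]
        Comp_assoc[OF eH v t[OF i]] comm[OF i] puv by simp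
    moreover have "Dom C (m i) = A i" "Cod C (m i) = Y i" using m(1)[OF i] by (auto simp: Hom_def)
    ultimately show ?thesis
      using diagonal_filler[OF e m(2)[OF i], of "\<pi> i \<cdot> u" "t i \<cdot> v"]
        Comp_Hom[OF u \<pi>[OF i]] Comp_Hom[OF v t[OF i]] by auto
  qed
  then obtain d where d: "\<And>i. i \<in> I \<Longrightarrow> d i \<in> Hom C (Cod C e) (A i)"
    "\<And>i. i \<in> I \<Longrightarrow> d i \<cdot> e = \<pi> i \<cdot> u" "\<And>i. i \<in> I \<Longrightarrow> m i \<cdot> d i = t i \<cdot> v"
    by metis
  have "\<exists>!h. h \<in> Hom C (Cod C e) L \<and> p \<cdot> h = v \<and> (\<forall>i \<in> I. \<pi> i \<cdot> h = d i)"
    using univ[OF v] d by simp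
  then obtain h where h: "h \<in> Hom C (Cod C e) L" "p \<cdot> h = v" "\<And>i. i \<in> I \<Longrightarrow> \<pi> i \<cdot> h = d i"
    by blast
  \<comment> \<open>The upper triangle is an equation between arrows into the limit, so the
    universal property is used a second time, now at \<open>Dom C e\<close>.\<close>
  have "\<exists>!h. h \<in> Hom C (Dom C e) L \<and> p \<cdot> h = v \<cdot> e \<and> (\<forall>i \<in> I. \<pi> i \<cdot> h = \<pi> i \<cdot> u)"
  proof (rule univ)
    show "v \<cdot> e \<in> Hom C (Dom C e) X" by (rule Comp_Hom[OF eH v])
    show "\<pi> i \<cdot> u \<in> Hom C (Dom C e) (A i)" if "i \<in> I" for i by (rule Comp_Hom[OF u \<pi>[OF that]])
    show "t i \<cdot> (v \<cdot> e) = m i \<cdot> (\<pi> i \<cdot> u)" if i: "i \<in> I" for i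
      using Comp_assoc[OF u \<pi>[OF i] m(1)[OF i]] Comp_assoc[OF u p t[OF i]] comm[OF i] puv by simp
  qed
  moreover have "h \<cdot> e \<in> Hom C (Dom C e) L" "p \<cdot> (h \<cdot> e) = v \<cdot> e"
    using Comp_Hom[OF eH h(1)] Comp_assoc[OF eH h(1) p] h(2) by simp_all
  moreover have "\<pi> i \<cdot> (h \<cdot> e) = \<pi> i \<cdot> u" if i: "i \<in> I" for i
    using Comp_assoc[OF eH h(1) \<pi>[OF i]] h(3)[OF i] d(2)[OF i] by simp
  ultimately have "h \<cdot> e = u" using u puv by blast
  then show "\<exists>h \<in> Hom C (Cod C e) L. h \<cdot> e = u \<and> p \<cdot> h = v" using h by blast
qed

lemma pullback_M:
  assumes pb: "is_pullback C f g P p1 p2" and g: "g \<in> M"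
  shows "p1 \<in> M"
proof (rule multi_pullback_M[where I = "UNIV :: unit set" and t = "\<lambda>_. f" and m = "\<lambda>_. g"
      and Y = "\<lambda>_. Cod C f" and A = "\<lambda>_. Dom C g" and \<pi> = "\<lambda>_. p2"])
  show "\<exists>!h. h \<in> Hom C B P \<and> p1 \<cdot> h = b \<and> (\<forall>i \<in> UNIV. p2 \<cdot> h = \<beta> i)"
    if "b \<in> Hom C B (Dom C f)" "\<And>i :: unit. i \<in> UNIV \<Longrightarrow> \<beta> i \<in> Hom C B (Dom C g)"
      "\<And>i. i \<in> UNIV \<Longrightarrow> f \<cdot> b = g \<cdot> \<beta> i" for B b \<beta>
    using pb that Hom_Ob(1)[OF that(1)] by (simp add: is_pullback_def)
qed (use pb g in \<open>auto simp: is_pullback_def Hom_def\<close>)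

text \<open>The diagonal filler of \<open>e\<close> against \<open>m\<close> is the factorisation.
  Consequently the \<open>M\<close>-part of an arrow lies below an \<open>M\<close>-subobject
  exactly when the whole arrow factors through it, and composites of relations can be tested before
  factorising.\<close>

lemma factors_through_cancel_E:
  assumes e: "e \<in> E" and m: "m \<in> M" and t: "t \<in> Ar C" "Dom C t = Cod C e" "Cod C t = Cod C m"
    and te: "factors_through C (t \<cdot> e) m"
  shows "factors_through C t m"
proof -
  obtain h where "h \<in> Hom C (Dom C (t \<cdot> e)) (Dom C m)" "m \<cdot> h = t \<cdot> e"
    using te unfolding factors_through_def by blast
  moreover have "Dom C (t \<cdot> e) = Dom C e" using t e by simp
  ultimately obtain d where "d \<in> Hom C (Cod C e) (Dom C m)" "m \<cdot> d = t"
    using diagonal_filler[OF e m, of h t] t by (auto simp: Hom_def)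
  then show ?thesis unfolding factors_through_def using t by auto
qed

section \<open>Subobject classes and their meets\<close>

lemma sub_class_self: "m \<in> M \<Longrightarrow> m \<in> sub_class C M m"
  by (simp add: sub_class_def factors_through_refl)

lemma sub_classD:
  assumes "n \<in> sub_class C M m"
  shows "n \<in> M" "Cod C n = Cod C m" "factors_through C m n" "factors_through C n m"
  using assms by (auto simp: sub_class_def)

lemma sub_class_eqI:
  assumes "m \<in> M" "n \<in> M" "Cod C m = Cod C n" "factors_through C m n" "factors_through C n m"
  shows "sub_class C M m = sub_class C M n"
  using assms factors_through_trans M_in_Ar unfolding sub_class_def
  by (intro Collect_cong) (metis (no_types, opaque_lifting))

lemma factors_through_sub_class:
  assumes "m \<in> M" "n \<in> sub_class C M m"
  shows "factors_through C t n \<longleftrightarrow> factors_through C t m"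
  using assms factors_through_trans sub_classD M_in_Ar by metis

lemma sub_le_sub_class_iff:
  assumes "a \<in> M" "b \<in> M"
  shows "sub_le C (sub_class C M a) (sub_class C M b) \<longleftrightarrow> factors_through C a b"
  unfolding sub_le_def
  using assms sub_class_self sub_classD factors_through_trans M_in_Ar by metis

lemma meet_eq_sub_class:
  assumes m: "m \<in> M" "Cod C m = X" and S: "\<S> \<subseteq> MSub C M X"
    and glb: "\<And>t. t \<in> Ar C \<Longrightarrow> Cod C t = X
      \<Longrightarrow> factors_through C t m \<longleftrightarrow> (\<forall>B \<in> \<S>. \<forall>b \<in> B. factors_through C t b)"
  shows "meet C M X \<S> = sub_class C M m"
proof -
  \<comment> \<open>Members of a class are interchangeable, so being below one is being below all;
    this reconciles the existentials in \<open>sub_le\<close> with the universal quantifier in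
    \<open>glb\<close>.\<close>
  have le: "sub_le C (sub_class C M t) B \<longleftrightarrow> (\<forall>b \<in> B. factors_through C t b)"
    if t: "t \<in> M" and B: "B \<in> \<S>" for t B
  proof -
    obtain n where n: "n \<in> M" "B = sub_class C M n" using S B by (auto simp: MSub_def)
    then show ?thesis
      using sub_le_sub_class_iff[OF t n(1)] factors_through_sub_class[OF n(1)]
        sub_class_self[OF n(1)] by blast
  qed
  have glb': "(\<forall>B \<in> \<S>. sub_le C (sub_class C M t) B) \<longleftrightarrow> factors_through C t m"
    if "t \<in> M" "Cod C t = X" for t
    using glb[of t] le[OF that(1)] that by simp
  show ?thesis
    unfolding meet_def
  proof (rule the_equality)
    have "sub_le C A' (sub_class C M m)" if A': "A' \<in> MSub C M X" "\<forall>B \<in> \<S>. sub_le C A' B" for A'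
    proof -
      obtain n where n: "n \<in> M" "A' = sub_class C M n" "Cod C n = X"
        using A'(1) by (auto simp: MSub_def)
      then show ?thesis
        using A'(2) glb'[OF n(1,3)] sub_le_sub_class_iff[OF n(1) m(1)] by simp
    qed
    moreover have "\<forall>B \<in> \<S>. sub_le C (sub_class C M m) B"
      using glb'[OF m] factors_through_refl m(1) by simp
    moreover have "sub_class C M m \<in> MSub C M X" using m by (auto simp: MSub_def)
    ultimately show "sub_class C M m \<in> MSub C M X \<and> (\<forall>B \<in> \<S>. sub_le C (sub_class C M m) B) \<and>
        (\<forall>A' \<in> MSub C M X. (\<forall>B \<in> \<S>. sub_le C A' B) \<longrightarrow> sub_le C A' (sub_class C M m))"
      by blast
    fix A
    assume A: "A \<in> MSub C M X \<and> (\<forall>B \<in> \<S>. sub_le C A B) \<and>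
        (\<forall>A' \<in> MSub C M X. (\<forall>B \<in> \<S>. sub_le C A' B) \<longrightarrow> sub_le C A' A)"
    then obtain n where n: "n \<in> M" "A = sub_class C M n" "Cod C n = X"
      by (auto simp: MSub_def)
    have "factors_through C n m" using A n glb'[OF n(1,3)] by blast
    moreover have "sub_le C (sub_class C M m) A"
      using A \<open>sub_class C M m \<in> MSub C M X\<close> \<open>\<forall>B \<in> \<S>. sub_le C (sub_class C M m) B\<close> by blast
    ultimately show "A = sub_class C M m"
      using n m sub_le_sub_class_iff[OF m(1) n(1)] sub_class_eqI[OF n(1) m(1)] by simp
  qed
qed

end

text \<open>The wide pullback of one representative per class. Well-poweredness makes the family
  small whatever \<open>\<S>\<close> is, and stability of \<open>M\<close> under such limits puts
  the intersection into \<open>M\<close>.\<close>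

lemma small_intersection:
  fixes C :: "('o, 'a) cat" (structure)
  assumes lim: "has_small_limits TYPE('u) C" and univ: "uncountable (UNIV :: 'u set)"
    and fs: "factorisation_system C E M" and wp: "well_powered TYPE('u) C M"
    and X: "X \<in> Ob C" and S: "\<S> \<subseteq> MSub C M X"
  shows "\<exists>m \<in> M. Cod C m = X \<and> (\<forall>t \<in> Ar C. Cod C t = X \<longrightarrow>
    factors_through C t m \<longleftrightarrow> (\<forall>B \<in> \<S>. \<forall>b \<in> B. factors_through C t b))"
proof -
  interpret factorisation_system C E M by fact
  have "small TYPE('u) (MSub C M X)" using wp X by (simp add: well_powered_def)
  then have sm: "small TYPE('u) \<S>" using small_lepoll subset_imp_lepoll[OF S] by blast
  have "\<exists>n. n \<in> M \<and> Cod C n = X \<and> B = sub_class C M n" if "B \<in> \<S>" for B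
    using S that by (auto simp: MSub_def)
  then obtain n where n: "\<And>B. B \<in> \<S> \<Longrightarrow> n B \<in> M" "\<And>B. B \<in> \<S> \<Longrightarrow> Cod C (n B) = X"
    "\<And>B. B \<in> \<S> \<Longrightarrow> B = sub_class C M (n B)"
    by metis
  have nH: "n B \<in> Hom C (Dom C (n B)) X" if "B \<in> \<S>" for B
    using n[OF that] by (simp add: Hom_def)
  obtain L p \<pi> where p: "p \<in> Hom C L X" and \<pi>: "\<And>B. B \<in> \<S> \<Longrightarrow> \<pi> B \<in> Hom C L (Dom C (n B))"
    and comm: "\<And>B. B \<in> \<S> \<Longrightarrow> Id C X \<cdot> p = n B \<cdot> \<pi> B"
    and un: "\<And>A a \<beta>. a \<in> Hom C A X \<Longrightarrow> (\<And>B. B \<in> \<S> \<Longrightarrow> \<beta> B \<in> Hom C A (Dom C (n B)))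
       \<Longrightarrow> (\<And>B. B \<in> \<S> \<Longrightarrow> Id C X \<cdot> a = n B \<cdot> \<beta> B)
       \<Longrightarrow> \<exists>!h. h \<in> Hom C A L \<and> p \<cdot> h = a \<and> (\<forall>B \<in> \<S>. \<pi> B \<cdot> h = \<beta> B)"
    by (rule small_limits_multi_pullback[OF lim univ category_axioms sm X Id_Hom[OF X] nH]) blast+
  have pM: "p \<in> M"
    by (rule multi_pullback_M[OF Id_Hom[OF X] nH n(1) p \<pi> comm un])
  have p_le: "factors_through C p (n B)" if "B \<in> \<S>" for B
    using \<pi>[OF that] comm[OF that] p Id_Comp[OF p] by (auto simp: factors_through_def Hom_def)
  have "factors_through C t p \<longleftrightarrow> (\<forall>B \<in> \<S>. \<forall>b \<in> B. factors_through C t b)"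
    if t: "t \<in> Ar C" "Cod C t = X" for t
  proof -
    have tH: "t \<in> Hom C (Dom C t) X" using t by (simp add: Hom_def)
    have "factors_through C t p" if B: "\<forall>B \<in> \<S>. factors_through C t (n B)"
    proof -
      \<comment> \<open>Factorisations through representatives that are not monic are not unique;
        any choice forms a cone, since the cone condition only asks that each composite with a
        representative be \<open>t\<close>.\<close>
      obtain \<beta> where \<beta>: "\<And>B. B \<in> \<S> \<Longrightarrow> \<beta> B \<in> Hom C (Dom C t) (Dom C (n B))"
        "\<And>B. B \<in> \<S> \<Longrightarrow> n B \<cdot> \<beta> B = t"
        using B unfolding factors_through_def by metis
      have "\<exists>!h. h \<in> Hom C (Dom C t) L \<and> p \<cdot> h = t \<and> (\<forall>B \<in> \<S>. \<pi> B \<cdot> h = \<beta> B)"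
        using un[OF tH, of \<beta>] \<beta> Id_Comp[OF tH] by simp
      then show ?thesis unfolding factors_through_def using Hom_Dom[OF p] by blast
    qed
    then have "factors_through C t p \<longleftrightarrow> (\<forall>B \<in> \<S>. factors_through C t (n B))"
      using factors_through_trans[OF _ p_le] M_in_Ar n(1) by blast
    moreover have "(\<forall>b \<in> B. factors_through C t b) \<longleftrightarrow> factors_through C t (n B)" if "B \<in> \<S>" for B
      using factors_through_sub_class[OF n(1)[OF that]] sub_class_self[OF n(1)[OF that]] n(3)[OF that]
      by metis
    ultimately show ?thesis by simp
  qed
  then show ?thesis using pM Hom_Cod[OF p] by blast
qed


subsection \<open>Relations and generalised elements\<close>

text \<open>Gathers what completeness and well-poweredness contribute, so that the calculus of
  relations is free of the universe type \<open>'u\<close>. Intersections are characterised against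
  every arrow \<open>t\<close> into \<open>X\<close>, because generalised elements are arbitrary
  arrows.\<close>

locale relational_category = factorisation_system C E M
  for C :: "('o, 'a) cat" (structure) and E M +
  assumes product_exists: "X \<in> Ob C \<Longrightarrow> Y \<in> Ob C \<Longrightarrow> \<exists>P p1 p2. is_product C X Y P p1 p2"
    and pullback_exists: "f \<in> Hom C X Z \<Longrightarrow> g \<in> Hom C Y Z \<Longrightarrow> \<exists>P p1 p2. is_pullback C f g P p1 p2"
    and intersection_exists: "X \<in> Ob C \<Longrightarrow> \<S> \<subseteq> MSub C M X \<Longrightarrow>
      \<exists>m \<in> M. Cod C m = X \<and> (\<forall>t \<in> Ar C. Cod C t = X \<longrightarrow>
        factors_through C t m \<longleftrightarrow> (\<forall>B \<in> \<S>. \<forall>b \<in> B. factors_through C t b))"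

lemma relational_category_if_complete:
  fixes C :: "('o, 'a) cat"
  assumes "has_small_limits TYPE('u) C" "uncountable (UNIV :: 'u set)"
    "factorisation_system C E M" "well_powered TYPE('u) C M"
  shows "relational_category C E M"
proof -
  interpret factorisation_system C E M by fact
  show ?thesis
    by unfold_locales
      (rule small_limits_product[OF assms(1,2) category_axioms] small_limits_pullback[OF assms(1,2) category_axioms]
        small_intersection[OF assms]; assumption)+
qed

text \<open>\<open>related C r x y\<close> says that the generalised elements \<open>x, y : A \<rightarrow> X\<close> are related by \<open>r\<close>.\<close>

definition related :: "('o, 'a) cat \<Rightarrow> 'a \<Rightarrow> 'a \<Rightarrow> 'a \<Rightarrow> bool" where
  "related C r x y \<longleftrightarrow> factors_through C (tuple C x y) r"

context relational_category
begin

section \<open>Chosen products and the elements of a relation\<close>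

lemma is_product_Prod:
  assumes "X \<in> Ob C" "Y \<in> Ob C"
  shows "is_product C X Y (Prod C X Y) (pr1 C X Y) (pr2 C X Y)"
proof -
  have "\<exists>z. case z of (P, p1, p2) \<Rightarrow> is_product C X Y P p1 p2"
    using product_exists[OF assms] by auto
  then have "case product_choice C X Y of (P, p1, p2) \<Rightarrow> is_product C X Y P p1 p2"
    unfolding product_choice_def by (rule someI_ex)
  then show ?thesis by (simp add: Prod_def pr1_def pr2_def split: prod.splits)
qed

lemma Prod_Ob: "X \<in> Ob C \<Longrightarrow> Y \<in> Ob C \<Longrightarrow> Prod C X Y \<in> Ob C"
  and pr1_Hom: "X \<in> Ob C \<Longrightarrow> Y \<in> Ob C \<Longrightarrow> pr1 C X Y \<in> Hom C (Prod C X Y) X"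
  and pr2_Hom: "X \<in> Ob C \<Longrightarrow> Y \<in> Ob C \<Longrightarrow> pr2 C X Y \<in> Hom C (Prod C X Y) Y"
  using is_product_Prod unfolding is_product_def by blast+

lemma product_eqI:
  assumes XY: "X \<in> Ob C" "Y \<in> Ob C" and h: "h \<in> Hom C A (Prod C X Y)" and k: "k \<in> Hom C A (Prod C X Y)"
    and eq: "pr1 C X Y \<cdot> h = pr1 C X Y \<cdot> k" "pr2 C X Y \<cdot> h = pr2 C X Y \<cdot> k"
  shows "h = k"
proof -
  have "\<exists>!z. z \<in> Hom C A (Prod C X Y) \<and> pr1 C X Y \<cdot> z = pr1 C X Y \<cdot> k \<and> pr2 C X Y \<cdot> z = pr2 C X Y \<cdot> k"
    using is_product_Prod[OF XY] Hom_Ob(1)[OF k] Comp_Hom[OF k pr1_Hom[OF XY]] Comp_Hom[OF k pr2_Hom[OF XY]]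
    unfolding is_product_def by simp
  then show ?thesis using h k eq by blast
qed

lemma tuple:
  assumes f: "f \<in> Hom C A X" and g: "g \<in> Hom C A Y"
  shows "tuple C f g \<in> Hom C A (Prod C X Y)" "pr1 C X Y \<cdot> tuple C f g = f"
    "pr2 C X Y \<cdot> tuple C f g = g"
proof -
  have dc: "Dom C f = A" "Cod C f = X" "Cod C g = Y" using f g by (auto simp: Hom_def)
  have "\<exists>!h. h \<in> Hom C A (Prod C X Y) \<and> pr1 C X Y \<cdot> h = f \<and> pr2 C X Y \<cdot> h = g"
    using is_product_Prod[OF Hom_Ob(2)[OF f] Hom_Ob(2)[OF g]] Hom_Ob(1)[OF f] f g
    unfolding is_product_def by simp
  from theI'[OF this]
  show "tuple C f g \<in> Hom C A (Prod C X Y)" "pr1 C X Y \<cdot> tuple C f g = f"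
    "pr2 C X Y \<cdot> tuple C f g = g"
    unfolding tuple_def dc by blast+
qed

lemma tuple_eqI:
  assumes XY: "X \<in> Ob C" "Y \<in> Ob C" and h: "h \<in> Hom C A (Prod C X Y)"
    and "pr1 C X Y \<cdot> h = f" "pr2 C X Y \<cdot> h = g"
  shows "tuple C f g = h"
proof -
  have f: "f \<in> Hom C A X" and g: "g \<in> Hom C A Y"
    using Comp_Hom[OF h pr1_Hom[OF XY]] Comp_Hom[OF h pr2_Hom[OF XY]] assms(4,5) by simp_all
  show ?thesis
    by (rule product_eqI[OF XY tuple(1)[OF f g] h]) (simp_all add: tuple[OF f g] assms(4,5))
qed

lemma is_relD:
  assumes "is_rel C M X X r" "X \<in> Ob C"
  shows "r \<in> M" "r \<in> Hom C (Dom C r) (Prod C X X)"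
    "pr1 C X X \<cdot> r \<in> Hom C (Dom C r) X" "pr2 C X X \<cdot> r \<in> Hom C (Dom C r) X"
proof -
  show "r \<in> M" and r: "r \<in> Hom C (Dom C r) (Prod C X X)"
    using assms by (auto simp: is_rel_def Hom_def)
  show "pr1 C X X \<cdot> r \<in> Hom C (Dom C r) X" "pr2 C X X \<cdot> r \<in> Hom C (Dom C r) X"
    using Comp_Hom[OF r] pr1_Hom pr2_Hom assms(2) by blast+
qed

text \<open>Speaking of the two legs instead of one arrow into the product matters later: a functor
  acts on legs directly, whereas it respects the product only through a comparison map.\<close>

lemma related_iff:
  assumes X: "X \<in> Ob C" and r: "r \<in> Hom C R (Prod C X X)"
    and xy: "x \<in> Hom C A X" "y \<in> Hom C A X"
  shows "related C r x y \<longleftrightarrow> (\<exists>c \<in> Hom C A R. (pr1 C X X \<cdot> r) \<cdot> c = x \<and> (pr2 C X X \<cdot> r) \<cdot> c = y)"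
proof -
  have "r \<cdot> c = tuple C x y \<longleftrightarrow> (pr1 C X X \<cdot> r) \<cdot> c = x \<and> (pr2 C X X \<cdot> r) \<cdot> c = y"
    if c: "c \<in> Hom C A R" for c
    using tuple_eqI[OF X X Comp_Hom[OF c r]] tuple(2,3)[OF xy] Comp_assoc[OF c r pr1_Hom[OF X X]]
      Comp_assoc[OF c r pr2_Hom[OF X X]] by metis
  then show ?thesis
    using Hom_Dom[OF tuple(1)[OF xy]] Hom_Dom[OF r]
    unfolding related_def factors_through_def by simp
qed

text \<open>Composing the witness with \<open>h\<close> gives a witness at the new stage. This
  stability reduces statements about all stages to one about a universal stage.\<close>

lemma related_Comp:
  assumes X: "X \<in> Ob C" and r: "is_rel C M X X r"
    and xy: "x \<in> Hom C A X" "y \<in> Hom C A X" and rel: "related C r x y" and h: "h \<in> Hom C B A"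
  shows "related C r (x \<cdot> h) (y \<cdot> h)"
proof -
  note r = is_relD[OF r X]
  obtain c where c: "c \<in> Hom C A (Dom C r)" "(pr1 C X X \<cdot> r) \<cdot> c = x" "(pr2 C X X \<cdot> r) \<cdot> c = y"
    using rel unfolding related_iff[OF X r(2) xy] by blast
  have "(pr1 C X X \<cdot> r) \<cdot> (c \<cdot> h) = x \<cdot> h" "(pr2 C X X \<cdot> r) \<cdot> (c \<cdot> h) = y \<cdot> h"
    using Comp_assoc[OF h c(1) r(3)] Comp_assoc[OF h c(1) r(4)] c(2,3) by simp_all
  then show ?thesis
    unfolding related_iff[OF X r(2) Comp_Hom[OF h xy(1)] Comp_Hom[OF h xy(2)]]
    using Comp_Hom[OF h c(1)] by blast
qed

lemma factors_through_iff_related: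
  assumes "X \<in> Ob C" "a \<in> Hom C A (Prod C X X)"
  shows "factors_through C a r \<longleftrightarrow> related C r (pr1 C X X \<cdot> a) (pr2 C X X \<cdot> a)"
  unfolding related_def using tuple_eqI[OF assms(1,1,2) refl refl] by simp

lemma related_mono:
  "related C q x y \<Longrightarrow> factors_through C q r \<Longrightarrow> r \<in> M \<Longrightarrow> related C r x y"
  unfolding related_def using factors_through_trans M_in_Ar by blast

lemma related_sub_class:
  "r \<in> M \<Longrightarrow> q \<in> sub_class C M r \<Longrightarrow> related C q x y \<longleftrightarrow> related C r x y"
  unfolding related_def by (rule factors_through_sub_class)

text \<open>The Yoneda lemma: it suffices to preserve the universal related pair, the two legs of \<open>r\<close>.\<close>

lemma related_preserving_iff:
  assumes f: "f \<in> Hom C X Y" and r: "is_rel C M X X r" and q: "is_rel C M Y Y q"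
  shows "related C q (f \<cdot> (pr1 C X X \<cdot> r)) (f \<cdot> (pr2 C X X \<cdot> r)) \<longleftrightarrow>
    (\<forall>A. \<forall>x \<in> Hom C A X. \<forall>y \<in> Hom C A X. related C r x y \<longrightarrow> related C q (f \<cdot> x) (f \<cdot> y))"
    (is "?L \<longleftrightarrow> ?R")
proof
  note X = Hom_Ob(1)[OF f] and Y = Hom_Ob(2)[OF f]
  note r' = is_relD[OF r X]
  show ?R if L: ?L
  proof (intro allI ballI impI)
    fix A x y assume xy: "x \<in> Hom C A X" "y \<in> Hom C A X" and rel: "related C r x y"
    obtain c where c: "c \<in> Hom C A (Dom C r)" "(pr1 C X X \<cdot> r) \<cdot> c = x" "(pr2 C X X \<cdot> r) \<cdot> c = y"
      using rel unfolding related_iff[OF X r'(2) xy] by blast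
    have "f \<cdot> x = (f \<cdot> (pr1 C X X \<cdot> r)) \<cdot> c" "f \<cdot> y = (f \<cdot> (pr2 C X X \<cdot> r)) \<cdot> c"
      using Comp_assoc[OF c(1) r'(3) f] Comp_assoc[OF c(1) r'(4) f] c(2,3) by simp_all
    then show "related C q (f \<cdot> x) (f \<cdot> y)"
      using related_Comp[OF Y q Comp_Hom[OF r'(3) f] Comp_Hom[OF r'(4) f] L c(1)] by simp
  qed
  show ?L if R: ?R
  proof -
    have "related C r (pr1 C X X \<cdot> r) (pr2 C X X \<cdot> r)"
      using factors_through_iff_related[OF X r'(2), of r] factors_through_refl[of r] r'(1) by simp
    then show ?thesis using R r'(3,4) by blast
  qed
qed

text \<open>The case \<open>f = Id C X\<close> of \<open>related_preserving_iff\<close>: containment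
  of relations is monotonicity of the identity.\<close>

lemma sub_rel_iff:
  assumes X: "X \<in> Ob C" and r: "is_rel C M X X r" and q: "is_rel C M X X q"
  shows "factors_through C r q \<longleftrightarrow>
    (\<forall>A. \<forall>x \<in> Hom C A X. \<forall>y \<in> Hom C A X. related C r x y \<longrightarrow> related C q x y)"
proof -
  note r' = is_relD[OF r X]
  have "related C q (Id C X \<cdot> (pr1 C X X \<cdot> r)) (Id C X \<cdot> (pr2 C X X \<cdot> r)) \<longleftrightarrow> factors_through C r q"
    unfolding factors_through_iff_related[OF X r'(2)] Id_Comp[OF r'(3)] Id_Comp[OF r'(4)] ..
  then show ?thesis
    unfolding related_preserving_iff[OF Id_Hom[OF X] r q] using Id_Comp by (metis (full_types))
qed

text \<open>The identity is the universal generalised element of \<open>X\<close>, and the diagonal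
  pairs it with itself.\<close>

lemma reflexive_rel_iff:
  assumes X: "X \<in> Ob C" and r: "is_rel C M X X r"
  shows "reflexive_rel C X r \<longleftrightarrow> (\<forall>A. \<forall>x \<in> Hom C A X. related C r x x)"
proof -
  have "reflexive_rel C X r \<longleftrightarrow> related C r (Id C X) (Id C X)"
    by (simp add: reflexive_rel_def diagonal_def related_def)
  moreover have "related C r x x" if "related C r (Id C X) (Id C X)" "x \<in> Hom C A X" for A x
    using related_Comp[OF X r Id_Hom[OF X] Id_Hom[OF X] that] Id_Comp[OF that(2)] by simp
  ultimately show ?thesis using Id_Hom[OF X] by blast
qed

text \<open>An arrow from \<open>A\<close> into the pullback \<open>P\<close> of \<open>r2\<close>
  and \<open>r1\<close> is a composable pair of witnesses at stage \<open>A\<close>, so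
  \<open>r1 \<cdot> p1\<close> and \<open>r2 \<cdot> p2\<close> are the universal outer elements of
  such a pair. The composite relation is the \<open>M\<close>-part of their tuple \<open>t\<close>;
  cancelling the \<open>E\<close>-part turns containment of the composite in \<open>r\<close> into
  relatedness of these two elements.\<close>

lemma transitive_rel_iff:
  assumes X: "X \<in> Ob C" and r: "is_rel C M X X r"
  shows "transitive_rel C E M X r \<longleftrightarrow>
    (\<forall>A. \<forall>x \<in> Hom C A X. \<forall>y \<in> Hom C A X. \<forall>z \<in> Hom C A X.
      related C r x y \<longrightarrow> related C r y z \<longrightarrow> related C r x z)"
proof -
  note r' = is_relD[OF r X]
  define r1 r2 where r12: "r1 = pr1 C X X \<cdot> r" "r2 = pr2 C X X \<cdot> r"
  have r12_Hom: "r1 \<in> Hom C (Dom C r) X" "r2 \<in> Hom C (Dom C r) X" using r' by (simp_all add: r12)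
  have "\<exists>z. case z of (P, p1, p2) \<Rightarrow> is_pullback C r2 r1 P p1 p2"
    using pullback_exists[OF r12_Hom(2,1)] by auto
  then have "case (SOME (P, p1, p2). is_pullback C r2 r1 P p1 p2) of (P, p1, p2) \<Rightarrow> is_pullback C r2 r1 P p1 p2"
    by (rule someI_ex)
  then obtain P p1 p2 where P: "(SOME (P, p1, p2). is_pullback C r2 r1 P p1 p2) = (P, p1, p2)"
    and pb: "is_pullback C r2 r1 P p1 p2"
    by (auto split: prod.splits)
  have p: "p1 \<in> Hom C P (Dom C r)" "p2 \<in> Hom C P (Dom C r)" "r2 \<cdot> p1 = r1 \<cdot> p2"
    using pb Hom_Dom[OF r12_Hom(1)] Hom_Dom[OF r12_Hom(2)] by (auto simp: is_pullback_def)
  define t where "t = tuple C (r1 \<cdot> p1) (r2 \<cdot> p2)"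
  have ends: "r1 \<cdot> p1 \<in> Hom C P X" "r2 \<cdot> p2 \<in> Hom C P X" "r1 \<cdot> p2 \<in> Hom C P X"
    using Comp_Hom[OF p(1) r12_Hom(1)] Comp_Hom[OF p(2) r12_Hom(2)] Comp_Hom[OF p(2) r12_Hom(1)] .
  have t: "t \<in> Hom C P (Prod C X X)" unfolding t_def by (rule tuple(1)[OF ends(1,2)])
  define m where "m = rel_comp C E M X X X r r"
  have m_def': "m = (SOME m. m \<in> M \<and> (\<exists>e \<in> E. Cod C e = Dom C m \<and> m \<cdot> e = t))"
    unfolding m_def rel_comp_def r12[symmetric] P t_def by simp
  have "\<exists>m. m \<in> M \<and> (\<exists>e \<in> E. Cod C e = Dom C m \<and> m \<cdot> e = t)"
    using factorisation[OF Hom_Ar[OF t]] by blast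
  then have "m \<in> M \<and> (\<exists>e \<in> E. Cod C e = Dom C m \<and> m \<cdot> e = t)"
    unfolding m_def' by (rule someI_ex)
  then obtain e where m: "m \<in> M" "e \<in> E" "Cod C e = Dom C m" "m \<cdot> e = t" by blast
  have "Cod C m = Prod C X X" using Hom_Cod[OF t] m by (metis Cod_Comp E_in_Ar M_in_Ar)
  \<comment> \<open>One direction composes with \<open>e\<close>, the other is the diagonal
    filler.\<close>
  then have "factors_through C m r \<longleftrightarrow> factors_through C t r"
    using factors_through_Comp[of m r e] factors_through_cancel_E[OF m(2) r'(1), of m] m r' Hom_Cod[OF r'(2)]
    by auto
  then have "transitive_rel C E M X r \<longleftrightarrow> related C r (r1 \<cdot> p1) (r2 \<cdot> p2)"
    unfolding transitive_rel_def m_def[symmetric] related_def t_def .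
  moreover have "related C r x z"
    if univ: "related C r (r1 \<cdot> p1) (r2 \<cdot> p2)" and xyz: "x \<in> Hom C A X" "y \<in> Hom C A X" "z \<in> Hom C A X"
      and xy: "related C r x y" and yz: "related C r y z" for A x y z
  proof -
    obtain a where a: "a \<in> Hom C A (Dom C r)" "r1 \<cdot> a = x" "r2 \<cdot> a = y"
      using xy unfolding related_iff[OF X r'(2) xyz(1,2)] r12 by blast
    obtain b where b: "b \<in> Hom C A (Dom C r)" "r1 \<cdot> b = y" "r2 \<cdot> b = z"
      using yz unfolding related_iff[OF X r'(2) xyz(2,3)] r12 by blast
    obtain h where h: "h \<in> Hom C A P" "p1 \<cdot> h = a" "p2 \<cdot> h = b"
      using pb a b Hom_Ob(1)[OF a(1)] Hom_Dom[OF r12_Hom(1)] Hom_Dom[OF r12_Hom(2)]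
      unfolding is_pullback_def by metis
    have "(r1 \<cdot> p1) \<cdot> h = x" "(r2 \<cdot> p2) \<cdot> h = z"
      using Comp_assoc[OF h(1) p(1) r12_Hom(1)] Comp_assoc[OF h(1) p(2) r12_Hom(2)] h a b by simp_all
    then show ?thesis using related_Comp[OF X r ends(1,2) univ h(1)] by simp
  qed
  \<comment> \<open>At stage \<open>P\<close> the middle element is
    \<open>r1 \<cdot> p2 = r2 \<cdot> p1\<close>, with \<open>p1\<close> and \<open>p2\<close>
    themselves as witnesses; elementwise transitivity there yields the universal case.\<close>
  moreover have "related C r (r1 \<cdot> p1) (r1 \<cdot> p2)" "related C r (r1 \<cdot> p2) (r2 \<cdot> p2)"
    unfolding related_iff[OF X r'(2) ends(1,3)] related_iff[OF X r'(2) ends(3,2)]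
    using p by (auto simp: r12)
  ultimately show ?thesis using ends by (metis (full_types))
qed

text \<open>\<open>monotone_arrow\<close> asks for a lift of \<open>f \<times> f\<close> between
  some representatives of the two classes. Such a lift exists iff \<open>f\<close> preserves related
  elements, and relatedness depends only on the class, so the existential over representatives
  collapses.\<close>

lemma monotone_arrow_iff_legs:
  assumes X: "X \<in> Ob C" and Y: "Y \<in> Ob C" and r: "is_rel C M X X r" and q: "is_rel C M Y Y q"
  shows "monotone_arrow C (X, sub_class C M r) f (Y, sub_class C M q) \<longleftrightarrow>
    f \<in> Hom C X Y \<and> related C q (f \<cdot> (pr1 C X X \<cdot> r)) (f \<cdot> (pr2 C X X \<cdot> r))"
proof (cases "f \<in> Hom C X Y")
  case f: True
  have step: "(\<exists>f' \<in> Hom C (Dom C r') (Dom C q'). q' \<cdot> f' = square C f \<cdot> r') \<longleftrightarrow>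
      (\<forall>A. \<forall>x \<in> Hom C A X. \<forall>y \<in> Hom C A X. related C r' x y \<longrightarrow> related C q' (f \<cdot> x) (f \<cdot> y))"
    if r': "is_rel C M X X r'" and q': "is_rel C M Y Y q'" for r' q'
  proof -
    note rD = is_relD[OF r' X]
    note fp = Comp_Hom[OF pr1_Hom[OF X X] f] Comp_Hom[OF pr2_Hom[OF X X] f]
    have sq: "square C f \<in> Hom C (Prod C X X) (Prod C Y Y)"
      "pr1 C Y Y \<cdot> square C f = f \<cdot> pr1 C X X" "pr2 C Y Y \<cdot> square C f = f \<cdot> pr2 C X X"
      unfolding square_def Hom_Dom[OF f] by (rule tuple[OF fp])+
    have "pr1 C Y Y \<cdot> (square C f \<cdot> r') = f \<cdot> (pr1 C X X \<cdot> r')"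
      "pr2 C Y Y \<cdot> (square C f \<cdot> r') = f \<cdot> (pr2 C X X \<cdot> r')"
      using Comp_assoc[OF rD(2) sq(1) pr1_Hom[OF Y Y]] Comp_assoc[OF rD(2) sq(1) pr2_Hom[OF Y Y]]
        Comp_assoc[OF rD(2) pr1_Hom[OF X X] f] Comp_assoc[OF rD(2) pr2_Hom[OF X X] f] sq(2,3)
      by simp_all
    moreover have sr: "square C f \<cdot> r' \<in> Hom C (Dom C r') (Prod C Y Y)" by (rule Comp_Hom[OF rD(2) sq(1)])
    ultimately have "factors_through C (square C f \<cdot> r') q' \<longleftrightarrow>
        related C q' (f \<cdot> (pr1 C X X \<cdot> r')) (f \<cdot> (pr2 C X X \<cdot> r'))"
      using factors_through_iff_related[OF Y sr] by simp
    then show ?thesis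
      unfolding related_preserving_iff[OF f r' q'] by (simp add: factors_through_def Hom_Dom[OF sr])
  qed
  have reps: "is_rel C M Z Z s'" if "is_rel C M Z Z s" "s' \<in> sub_class C M s" for Z s s'
    using that sub_classD by (auto simp: is_rel_def)
  have inv: "related C r' x y \<longleftrightarrow> related C r x y" "related C q' x y \<longleftrightarrow> related C q x y"
    if "r' \<in> sub_class C M r" "q' \<in> sub_class C M q" for r' q' x y
    using that r q related_sub_class by (auto simp: is_rel_def)
  have "monotone_arrow C (X, sub_class C M r) f (Y, sub_class C M q) \<longleftrightarrow>
      (\<exists>r' \<in> sub_class C M r. \<exists>q' \<in> sub_class C M q.
        \<forall>A. \<forall>x \<in> Hom C A X. \<forall>y \<in> Hom C A X. related C r' x y \<longrightarrow> related C q' (f \<cdot> x) (f \<cdot> y))"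
    unfolding monotone_arrow_def fst_conv snd_conv using f step reps[OF r] reps[OF q] by simp
  also have "\<dots> \<longleftrightarrow> (\<exists>r' \<in> sub_class C M r. \<exists>q' \<in> sub_class C M q.
        \<forall>A. \<forall>x \<in> Hom C A X. \<forall>y \<in> Hom C A X. related C r x y \<longrightarrow> related C q (f \<cdot> x) (f \<cdot> y))"
    by (intro bex_cong refl) (simp add: inv)
  also have "\<dots> \<longleftrightarrow> related C q (f \<cdot> (pr1 C X X \<cdot> r)) (f \<cdot> (pr2 C X X \<cdot> r))"
    unfolding related_preserving_iff[OF f r q] using r q sub_class_self by (auto simp: is_rel_def)
  finally show ?thesis using f by simp
qed (simp add: monotone_arrow_def)

lemma monotone_arrow_iff:
  assumes "X \<in> Ob C" "Y \<in> Ob C" "is_rel C M X X r" "is_rel C M Y Y q"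
  shows "monotone_arrow C (X, sub_class C M r) f (Y, sub_class C M q) \<longleftrightarrow> f \<in> Hom C X Y \<and>
    (\<forall>A. \<forall>x \<in> Hom C A X. \<forall>y \<in> Hom C A X. related C r x y \<longrightarrow> related C q (f \<cdot> x) (f \<cdot> y))"
  using monotone_arrow_iff_legs[OF assms] related_preserving_iff[OF _ assms(3,4)] by blast

text \<open>The pullback of \<open>q\<close> along \<open>f \<times> f\<close>; it is again a
  relation because \<open>M\<close> is stable under pullback.\<close>

lemma inverse_image:
  assumes f: "f \<in> Hom C X Y" and q: "is_rel C M Y Y q"
  obtains p where "is_rel C M X X p"
    "\<And>A x y. x \<in> Hom C A X \<Longrightarrow> y \<in> Hom C A X \<Longrightarrow> related C p x y \<longleftrightarrow> related C q (f \<cdot> x) (f \<cdot> y)"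
proof -
  note X = Hom_Ob(1)[OF f] and Y = Hom_Ob(2)[OF f]
  note fp = Comp_Hom[OF pr1_Hom[OF X X] f] Comp_Hom[OF pr2_Hom[OF X X] f]
  have sq: "square C f \<in> Hom C (Prod C X X) (Prod C Y Y)"
    "pr1 C Y Y \<cdot> square C f = f \<cdot> pr1 C X X" "pr2 C Y Y \<cdot> square C f = f \<cdot> pr2 C X X"
    unfolding square_def Hom_Dom[OF f] by (rule tuple[OF fp])+
  have sq_tuple: "square C f \<cdot> tuple C x y = tuple C (f \<cdot> x) (f \<cdot> y)"
    if xy: "x \<in> Hom C A X" "y \<in> Hom C A X" for A x y
    using tuple[OF xy] sq(2,3) Comp_assoc[OF tuple(1)[OF xy] sq(1) pr1_Hom[OF Y Y]]
      Comp_assoc[OF tuple(1)[OF xy] sq(1) pr2_Hom[OF Y Y]]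
      Comp_assoc[OF tuple(1)[OF xy] pr1_Hom[OF X X] f] Comp_assoc[OF tuple(1)[OF xy] pr2_Hom[OF X X] f]
    by (intro tuple_eqI[OF Y Y Comp_Hom[OF tuple(1)[OF xy] sq(1)], symmetric]) simp_all
  obtain P p1 p2 where pb: "is_pullback C (square C f) q P p1 p2"
    using pullback_exists[OF sq(1) is_relD(2)[OF q Y]] by blast
  have pD: "p1 \<in> Hom C P (Prod C X X)" "p2 \<in> Hom C P (Dom C q)" "square C f \<cdot> p1 = q \<cdot> p2"
    using pb Hom_Dom[OF sq(1)] by (auto simp: is_pullback_def)
  show thesis
  proof
    show "is_rel C M X X p1"
      using pullback_M[OF pb is_relD(1)[OF q Y]] pD by (auto simp: is_rel_def Hom_def)
    fix A x y assume xy: "x \<in> Hom C A X" "y \<in> Hom C A X"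
    note t = tuple(1)[OF xy]
    have "(\<exists>h \<in> Hom C A P. p1 \<cdot> h = tuple C x y) \<longleftrightarrow>
        (\<exists>c \<in> Hom C A (Dom C q). q \<cdot> c = square C f \<cdot> tuple C x y)"
    proof
      assume "\<exists>h \<in> Hom C A P. p1 \<cdot> h = tuple C x y"
      then obtain h where h: "h \<in> Hom C A P" "p1 \<cdot> h = tuple C x y" by blast
      have "q \<cdot> (p2 \<cdot> h) = square C f \<cdot> tuple C x y"
        using Comp_assoc[OF h(1) pD(2) is_relD(2)[OF q Y]] Comp_assoc[OF h(1) pD(1) sq(1)] pD(3) h(2)
        by simp
      then show "\<exists>c \<in> Hom C A (Dom C q). q \<cdot> c = square C f \<cdot> tuple C x y"
        using Comp_Hom[OF h(1) pD(2)] by blast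
    next
      assume "\<exists>c \<in> Hom C A (Dom C q). q \<cdot> c = square C f \<cdot> tuple C x y"
      then obtain c where c: "c \<in> Hom C A (Dom C q)" "square C f \<cdot> tuple C x y = q \<cdot> c" by metis
      have "\<exists>!h. h \<in> Hom C A P \<and> p1 \<cdot> h = tuple C x y \<and> p2 \<cdot> h = c"
        using pb t c Hom_Ob(1)[OF t] Hom_Dom[OF sq(1)] unfolding is_pullback_def by simp
      then show "\<exists>h \<in> Hom C A P. p1 \<cdot> h = tuple C x y" by blast
    qed
    then show "related C p1 x y \<longleftrightarrow> related C q (f \<cdot> x) (f \<cdot> y)"
      unfolding related_def factors_through_def sq_tuple[OF xy, symmetric]
        Hom_Dom[OF t] Hom_Dom[OF Comp_Hom[OF t sq(1)]] Hom_Dom[OF pD(1)] .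
  qed
qed

text \<open>The meet is impredicative: it runs over all transitive relations containing
  \<open>r\<close>, of which the result turns out to be one. Leastness holds because every
  competitor takes part in the meet.\<close>

lemma transitive_closure_exists:
  assumes X: "X \<in> Ob C" and r: "is_rel C M X X r"
  obtains c where "is_rel C M X X c" "transitive_closure C E M X r = sub_class C M c"
    "factors_through C r c" "transitive_rel C E M X c"
    "\<And>q. is_rel C M X X q \<Longrightarrow> factors_through C r q \<Longrightarrow> transitive_rel C E M X q \<Longrightarrow> factors_through C c q"
proof -
  define Q where "Q = {q. is_rel C M X X q \<and> factors_through C r q \<and> transitive_rel C E M X q}"
  have S: "sub_class C M ` Q \<subseteq> MSub C M (Prod C X X)"
    by (auto simp: Q_def MSub_def is_rel_def)
  obtain c where c: "c \<in> M" "Cod C c = Prod C X X"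
    and glb: "\<And>t. t \<in> Ar C \<Longrightarrow> Cod C t = Prod C X X \<Longrightarrow>
        factors_through C t c \<longleftrightarrow> (\<forall>B \<in> sub_class C M ` Q. \<forall>b \<in> B. factors_through C t b)"
    using intersection_exists[OF Prod_Ob[OF X X] S] by blast
  have Q_M: "q \<in> M" if "q \<in> Q" for q using that by (simp add: Q_def is_rel_def)
  have glb': "factors_through C t c \<longleftrightarrow> (\<forall>q \<in> Q. factors_through C t q)"
    if t: "t \<in> Ar C" "Cod C t = Prod C X X" for t
  proof -
    have "(\<forall>b \<in> sub_class C M q. factors_through C t b) \<longleftrightarrow> factors_through C t q" if "q \<in> Q" for q
      using factors_through_sub_class[OF Q_M[OF that]] sub_class_self[OF Q_M[OF that]] by blast
    then show ?thesis unfolding glb[OF t] by simp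
  qed
  have c_rel: "is_rel C M X X c" using c by (simp add: is_rel_def)
  \<comment> \<open>A tuple is an arrow into the product, so the lower-bound property applies to it
    and relatedness by the meet becomes a conjunction over \<open>Q\<close>.\<close>
  have related_c: "related C c x y \<longleftrightarrow> (\<forall>q \<in> Q. related C q x y)"
    if "x \<in> Hom C A X" "y \<in> Hom C A X" for A x y
    unfolding related_def using tuple(1)[OF that] by (intro glb') (auto simp: Hom_def)
  show thesis
  proof
    show "is_rel C M X X c" by fact
    have "{sub_class C M q | q. is_rel C M X X q \<and> factors_through C r q \<and> transitive_rel C E M X q}
        = sub_class C M ` Q"
      by (auto simp: Q_def)
    then show "transitive_closure C E M X r = sub_class C M c"
      unfolding transitive_closure_def using meet_eq_sub_class[OF c S glb] by simp
    show "factors_through C r c"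
      using glb'[of r] is_relD(2)[OF r X] by (auto simp: Hom_def Q_def)
    show "factors_through C c q"
      if "is_rel C M X X q" "factors_through C r q" "transitive_rel C E M X q" for q
      using that glb'[of c] c factors_through_refl[of c] by (auto simp: Q_def)
    show "transitive_rel C E M X c"
      unfolding transitive_rel_iff[OF X c_rel]
    proof (intro allI ballI impI)
      fix A x y z assume xyz: "x \<in> Hom C A X" "y \<in> Hom C A X" "z \<in> Hom C A X"
        and xy: "related C c x y" and yz: "related C c y z"
      have "related C q x z" if "q \<in> Q" for q
      proof -
        have q: "is_rel C M X X q" "transitive_rel C E M X q" using that by (simp_all add: Q_def)
        have "related C q x y" "related C q y z"
          using xy yz that related_c[OF xyz(1,2)] related_c[OF xyz(2,3)] by blast+
        then show ?thesis using q(2) xyz unfolding transitive_rel_iff[OF X q(1)] by blast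
      qed
      then show "related C c x z" using related_c[OF xyz(1,3)] by blast
    qed
  qed
qed

section \<open>The category of preorders\<close>

lemma ord_objects_cases:
  assumes "P \<in> ord_objects C E M"
  obtains X r where "P = (X, sub_class C M r)" "X \<in> Ob C" "is_preorder C E M X r" "is_rel C M X X r"
  using assms by (auto simp: ord_objects_def is_preorder_def)

lemma ord_objects_I:
  "X \<in> Ob C \<Longrightarrow> is_preorder C E M X r \<Longrightarrow> (X, sub_class C M r) \<in> ord_objects C E M"
  by (auto simp: ord_objects_def)

lemma is_preorder_iff:
  assumes "X \<in> Ob C" "is_rel C M X X r"
  shows "is_preorder C E M X r \<longleftrightarrow> (\<forall>A. \<forall>x \<in> Hom C A X. related C r x x) \<and>
    (\<forall>A. \<forall>x \<in> Hom C A X. \<forall>y \<in> Hom C A X. \<forall>z \<in> Hom C A X.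
      related C r x y \<longrightarrow> related C r y z \<longrightarrow> related C r x z)"
  unfolding is_preorder_def using assms reflexive_rel_iff[OF assms] transitive_rel_iff[OF assms] by simp

lemma Hom_Ord:
  "Hom (Ord C E M) P Q = {(P, f, Q) | f. P \<in> ord_objects C E M \<and> Q \<in> ord_objects C E M \<and> monotone_arrow C P f Q}"
  by (auto simp: Hom_def Ord_def)

lemma monotone_arrow_Comp:
  assumes P: "P \<in> ord_objects C E M" and Q: "Q \<in> ord_objects C E M" and R: "R \<in> ord_objects C E M"
    and f: "monotone_arrow C P f Q" and g: "monotone_arrow C Q g R"
  shows "monotone_arrow C P (g \<cdot> f) R"
proof -
  obtain X r where X: "P = (X, sub_class C M r)" "X \<in> Ob C" "is_rel C M X X r"
    using ord_objects_cases[OF P] by metis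
  obtain Y q where Y: "Q = (Y, sub_class C M q)" "Y \<in> Ob C" "is_rel C M Y Y q"
    using ord_objects_cases[OF Q] by metis
  obtain Z s where Z: "R = (Z, sub_class C M s)" "Z \<in> Ob C" "is_rel C M Z Z s"
    using ord_objects_cases[OF R] by metis
  note f = f[unfolded X(1) Y(1) monotone_arrow_iff[OF X(2) Y(2) X(3) Y(3)]]
  note g = g[unfolded Y(1) Z(1) monotone_arrow_iff[OF Y(2) Z(2) Y(3) Z(3)]]
  have fH: "f \<in> Hom C X Y" and gH: "g \<in> Hom C Y Z" using f g by blast+
  show ?thesis
    unfolding X(1) Z(1) monotone_arrow_iff[OF X(2) Z(2) X(3) Z(3)]
  proof (intro conjI allI ballI impI)
    show "g \<cdot> f \<in> Hom C X Z" by (rule Comp_Hom[OF fH gH])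
    fix A x y assume xy: "x \<in> Hom C A X" "y \<in> Hom C A X" "related C r x y"
    then have "related C s (g \<cdot> (f \<cdot> x)) (g \<cdot> (f \<cdot> y))"
      using f g Comp_Hom[OF xy(1) fH] Comp_Hom[OF xy(2) fH] by blast
    then show "related C s ((g \<cdot> f) \<cdot> x) ((g \<cdot> f) \<cdot> y)"
      using Comp_assoc[OF xy(1) fH gH] Comp_assoc[OF xy(2) fH gH] by simp
  qed
qed

lemma monotone_arrow_Id:
  assumes "P \<in> ord_objects C E M"
  shows "monotone_arrow C P (Id C (fst P)) P"
proof -
  obtain X r where X: "P = (X, sub_class C M r)" "X \<in> Ob C" "is_rel C M X X r"
    using ord_objects_cases[OF assms] by metis
  then show ?thesis
    using monotone_arrow_iff[OF X(2,2,3,3)] Id_Hom[OF X(2)] Id_Comp by auto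
qed

lemma monotone_arrow_Hom: "monotone_arrow C P f Q \<Longrightarrow> f \<in> Hom C (fst P) (fst Q)"
  by (simp add: monotone_arrow_def)

lemma category_Ord: "category (Ord C E M)"
proof
  have Comp_Ord: "Comp (Ord C E M) (Q', g, R) (P, f, Q) = (P, g \<cdot> f, R)" for Q' g R P f Q
    by (simp add: Ord_def)
  have Id_Ord: "Id (Ord C E M) P = (P, Id C (fst P), P)" for P by (simp add: Ord_def)
  show "Dom (Ord C E M) f \<in> Ob (Ord C E M)" "Cod (Ord C E M) f \<in> Ob (Ord C E M)"
    if "f \<in> Ar (Ord C E M)" for f
    using that by (auto simp: Ord_def)
  show "Id (Ord C E M) P \<in> Hom (Ord C E M) P P" if "P \<in> Ob (Ord C E M)" for P
  proof -
    have "P \<in> ord_objects C E M" using that by (simp add: Ord_def)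
    then show ?thesis using monotone_arrow_Id by (simp add: Hom_Ord Id_Ord)
  qed
  show "Comp (Ord C E M) g f \<in> Hom (Ord C E M) P R"
    if "f \<in> Hom (Ord C E M) P Q" "g \<in> Hom (Ord C E M) Q R" for f g P Q R
    using that monotone_arrow_Comp[of P Q R] by (auto simp: Hom_Ord Comp_Ord)
  show "Comp (Ord C E M) f (Id (Ord C E M) P) = f" if "f \<in> Hom (Ord C E M) P Q" for f P Q
    using that Comp_Id[OF monotone_arrow_Hom[of P _ Q]] by (auto simp: Hom_Ord Comp_Ord Id_Ord)
  show "Comp (Ord C E M) (Id (Ord C E M) Q) f = f" if "f \<in> Hom (Ord C E M) P Q" for f P Q
    using that Id_Comp[OF monotone_arrow_Hom[of P _ Q]] by (auto simp: Hom_Ord Comp_Ord Id_Ord)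
  show "Comp (Ord C E M) (Comp (Ord C E M) h g) f = Comp (Ord C E M) h (Comp (Ord C E M) g f)"
    if "f \<in> Hom (Ord C E M) P Q" "g \<in> Hom (Ord C E M) Q R" "h \<in> Hom (Ord C E M) R S" for f g h P Q R S
    using that Comp_assoc[OF monotone_arrow_Hom[of P _ Q] monotone_arrow_Hom[of Q _ R] monotone_arrow_Hom[of R _ S]]
    by (auto simp: Hom_Ord Comp_Ord)
qed

end


subsection \<open>Lifting the adjunction\<close>

text \<open>Projecting cancels the comparison map and leaves the functor applied to the legs. The
  functor is arbitrary because both \<open>F\<close> and \<open>G\<close> are instances, with the
  categories exchanged.\<close>

lemma image_rel:
  assumes C: "relational_category C EC MC" and D: "relational_category D ED MD"
    and T: "is_functor C D T" and S: "S \<in> Ob C" and q: "q \<in> Hom C Q (Prod C S S)"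
  shows "image_rel C D T S q \<in> Hom D (FOb T Q) (Prod D (FOb T S) (FOb T S))"
    "pr1 D (FOb T S) (FOb T S) \<cdot>\<^bsub>D\<^esub> image_rel C D T S q = FAr T (pr1 C S S \<cdot>\<^bsub>C\<^esub> q)"
    "pr2 D (FOb T S) (FOb T S) \<cdot>\<^bsub>D\<^esub> image_rel C D T S q = FAr T (pr2 C S S \<cdot>\<^bsub>C\<^esub> q)"
proof -
  interpret C: relational_category C EC MC by fact
  interpret D: relational_category D ED MD by fact
  note TS = is_functorD(3)[OF T S]
  note Tp = is_functorD(4)[OF T C.pr1_Hom[OF S S]] is_functorD(4)[OF T C.pr2_Hom[OF S S]]
  note cmp = D.tuple[OF Tp, folded comparison_def]
  note Tq = is_functorD(4)[OF T q]
  show "image_rel C D T S q \<in> Hom D (FOb T Q) (Prod D (FOb T S) (FOb T S))"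
    unfolding image_rel_def by (rule D.Comp_Hom[OF Tq cmp(1)])
  show "pr1 D (FOb T S) (FOb T S) \<cdot>\<^bsub>D\<^esub> image_rel C D T S q = FAr T (pr1 C S S \<cdot>\<^bsub>C\<^esub> q)"
    "pr2 D (FOb T S) (FOb T S) \<cdot>\<^bsub>D\<^esub> image_rel C D T S q = FAr T (pr2 C S S \<cdot>\<^bsub>C\<^esub> q)"
    unfolding image_rel_def
    using D.Comp_assoc[OF Tq cmp(1) D.pr1_Hom[OF TS TS]] D.Comp_assoc[OF Tq cmp(1) D.pr2_Hom[OF TS TS]]
      cmp(2,3) is_functorD(6)[OF T q C.pr1_Hom[OF S S]] is_functorD(6)[OF T q C.pr2_Hom[OF S S]]
    by simp_all
qed

text \<open>Ensures that equivalent relations have equivalent images, hence that the object maps are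
  well defined on classes.\<close>

lemma image_rel_mono:
  assumes C: "relational_category C EC MC" and D: "relational_category D ED MD"
    and T: "is_functor C D T" and S: "S \<in> Ob C"
    and q: "q \<in> Hom C Q (Prod C S S)" and q': "q' \<in> Hom C Q' (Prod C S S)"
    and le: "factors_through C q q'"
  shows "factors_through D (image_rel C D T S q) (image_rel C D T S q')"
proof -
  interpret C: relational_category C EC MC by fact
  interpret D: relational_category D ED MD by fact
  obtain h where h: "h \<in> Hom C Q Q'" "q' \<cdot>\<^bsub>C\<^esub> h = q"
    using le C.Hom_Dom[OF q] C.Hom_Dom[OF q'] unfolding factors_through_def by auto
  have cmp: "comparison C D T S \<in> Hom D (FOb T (Prod C S S)) (Prod D (FOb T S) (FOb T S))"
    unfolding comparison_def
    by (rule D.tuple(1)[OF is_functorD(4)[OF T C.pr1_Hom[OF S S]] is_functorD(4)[OF T C.pr2_Hom[OF S S]]])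
  have Th: "FAr T h \<in> Hom D (FOb T Q) (FOb T Q')" by (rule is_functorD(4)[OF T h(1)])
  have "image_rel C D T S q' \<cdot>\<^bsub>D\<^esub> FAr T h = image_rel C D T S q"
    using D.Comp_assoc[OF Th is_functorD(4)[OF T q'] cmp] is_functorD(6)[OF T h(1) q'] h(2)
    by (simp add: image_rel_def)
  then show ?thesis
    unfolding factors_through_def
    using Th D.Hom_Dom[OF image_rel(1)[OF C D T S q]] D.Hom_Dom[OF image_rel(1)[OF C D T S q']] by auto
qed

text \<open>The transposition \<open>\<phi>\<close> is a parameter since the lifted adjunction
  reuses this very bijection on underlying arrows.\<close>

locale relational_adjunction =
  C: relational_category C EC MC + D: relational_category D ED MD
  for C :: "('oc, 'ac) cat" and D :: "('od, 'ad) cat" and EC MC ED MD +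
  fixes F :: "('oc, 'ac, 'od, 'ad) funct" and G :: "('od, 'ad, 'oc, 'ac) funct"
    and \<phi> :: "'oc \<Rightarrow> 'od \<Rightarrow> 'ad \<Rightarrow> 'ac"
  assumes functor_F: "is_functor C D F" and functor_G: "is_functor D C G"
    and transpose_bij: "S \<in> Ob C \<Longrightarrow> X \<in> Ob D \<Longrightarrow>
      bij_betw (\<phi> S X) (Hom D (FOb F S) X) (Hom C S (FOb G X))"
    and transpose_natural: "s \<in> Hom C S' S \<Longrightarrow> x \<in> Hom D X X' \<Longrightarrow> h \<in> Hom D (FOb F S) X \<Longrightarrow>
      \<phi> S' X' (x \<cdot>\<^bsub>D\<^esub> h \<cdot>\<^bsub>D\<^esub> FAr F s) = FAr G x \<cdot>\<^bsub>C\<^esub> \<phi> S X h \<cdot>\<^bsub>C\<^esub> s"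
    and F_M: "m \<in> MC \<Longrightarrow> FAr F m \<in> MD" and G_M: "n \<in> MD \<Longrightarrow> FAr G n \<in> MC"
    and comparison_F_M: "S \<in> Ob C \<Longrightarrow> comparison C D F S \<in> MD"
begin

abbreviation "left_ob \<equiv> Ord_left_ob C D ED MD F"
abbreviation "right_ob \<equiv> Ord_right_ob C D MC G"

lemmas rel_cats = C.relational_category_axioms D.relational_category_axioms
lemmas F_simps = is_functorD(3-)[OF functor_F]
lemmas G_simps = is_functorD(3-)[OF functor_G]
lemmas image_F = image_rel[OF rel_cats functor_F]
lemmas image_G = image_rel[OF rel_cats(2,1) functor_G]

section \<open>Transposition along the adjunction\<close>

lemma transpose_Hom: "S \<in> Ob C \<Longrightarrow> h \<in> Hom D (FOb F S) X \<Longrightarrow> \<phi> S X h \<in> Hom C S (FOb G X)"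
  using bij_betwE[OF transpose_bij[OF _ D.Hom_Ob(2)]] by blast

lemma transpose_inj:
  assumes "S \<in> Ob C" "h \<in> Hom D (FOb F S) X" "h' \<in> Hom D (FOb F S) X" "\<phi> S X h = \<phi> S X h'"
  shows "h = h'"
  using inj_onD[OF bij_betw_imp_inj_on[OF transpose_bij[OF assms(1) D.Hom_Ob(2)[OF assms(2)]]] assms(4,2,3)] .

lemma transpose_surj:
  assumes "k \<in> Hom C S (FOb G X)" "X \<in> Ob D"
  obtains h where "h \<in> Hom D (FOb F S) X" "\<phi> S X h = k"
proof -
  have "k \<in> \<phi> S X ` Hom D (FOb F S) X"
    unfolding bij_betw_imp_surj_on[OF transpose_bij[OF C.Hom_Ob(1)[OF assms(1)] assms(2)]] by fact
  then show thesis using that by (elim imageE) simp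
qed

lemma transpose_Comp:
  assumes S: "S \<in> Ob C" and h: "h \<in> Hom D (FOb F S) X" and x: "x \<in> Hom D X X'"
  shows "\<phi> S X' (x \<cdot>\<^bsub>D\<^esub> h) = FAr G x \<cdot>\<^bsub>C\<^esub> \<phi> S X h"
  using transpose_natural[OF C.Id_Hom[OF S] x h] F_simps(3)[OF S] D.Comp_Id[OF D.Comp_Hom[OF h x]]
    C.Comp_Id[OF C.Comp_Hom[OF transpose_Hom[OF S h] G_simps(2)[OF x]]]
  by simp

lemma transpose_Comp_F:
  assumes s: "s \<in> Hom C S' S" and h: "h \<in> Hom D (FOb F S) X"
  shows "\<phi> S' X (h \<cdot>\<^bsub>D\<^esub> FAr F s) = \<phi> S X h \<cdot>\<^bsub>C\<^esub> s"
  using transpose_natural[OF s D.Id_Hom[OF D.Hom_Ob(2)[OF h]] h] D.Id_Comp[OF h]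
    G_simps(3)[OF D.Hom_Ob(2)[OF h]] C.Id_Comp[OF transpose_Hom[OF C.Hom_Ob(2)[OF s] h]]
  by simp

text \<open>Right adjoints preserve products. Isomorphisms belong to \<open>MC\<close>, so this
  provides for \<open>G\<close> the counterpart of \<open>comparison_F_M\<close>.\<close>

lemma comparison_G_iso:
  assumes X: "X \<in> Ob D"
  shows "iso C (comparison D C G X)"
proof -
  define P where "P = Prod C (FOb G X) (FOb G X)"
  note GX = G_simps(1)[OF X]
  note P_pr = C.pr1_Hom[OF GX GX, folded P_def] C.pr2_Hom[OF GX GX, folded P_def]
  note P_Ob = C.Prod_Ob[OF GX GX, folded P_def]
  note p = D.pr1_Hom[OF X X] D.pr2_Hom[OF X X]
  note cmp = C.tuple[OF G_simps(2)[OF p(1)] G_simps(2)[OF p(2)], folded comparison_def P_def]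
  \<comment> \<open>The inverse is built by transposing both projections of \<open>P\<close> back to
    \<open>D\<close>, pairing them there, and transposing the pair.\<close>
  obtain u1 where u1: "u1 \<in> Hom D (FOb F P) X" "\<phi> P X u1 = pr1 C (FOb G X) (FOb G X)"
    using transpose_surj[OF P_pr(1) X] .
  obtain u2 where u2: "u2 \<in> Hom D (FOb F P) X" "\<phi> P X u2 = pr2 C (FOb G X) (FOb G X)"
    using transpose_surj[OF P_pr(2) X] .
  note k = D.tuple[OF u1(1) u2(1)]
  define c' where "c' = \<phi> P (Prod D X X) (tuple D u1 u2)"
  have c': "c' \<in> Hom C P (FOb G (Prod D X X))"
    unfolding c'_def by (rule transpose_Hom[OF P_Ob k(1)])
  have Gp_c': "FAr G (pr1 D X X) \<cdot>\<^bsub>C\<^esub> c' = pr1 C (FOb G X) (FOb G X)"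
    "FAr G (pr2 D X X) \<cdot>\<^bsub>C\<^esub> c' = pr2 C (FOb G X) (FOb G X)"
    unfolding c'_def using transpose_Comp[OF P_Ob k(1) p(1)] transpose_Comp[OF P_Ob k(1) p(2)] k(2,3) u1 u2
    by simp_all
  \<comment> \<open>Equality of arrows into the image of the product under \<open>G\<close> is
    checked after transposing back, where the target is a product of \<open>D\<close>.\<close>
  have jointly_monic: "a = b"
    if a: "a \<in> Hom C A (FOb G (Prod D X X))" and b: "b \<in> Hom C A (FOb G (Prod D X X))"
      and eq: "FAr G (pr1 D X X) \<cdot>\<^bsub>C\<^esub> a = FAr G (pr1 D X X) \<cdot>\<^bsub>C\<^esub> b"
        "FAr G (pr2 D X X) \<cdot>\<^bsub>C\<^esub> a = FAr G (pr2 D X X) \<cdot>\<^bsub>C\<^esub> b" for A a b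
  proof -
    note A = C.Hom_Ob(1)[OF a]
    obtain a' where a': "a' \<in> Hom D (FOb F A) (Prod D X X)" "\<phi> A (Prod D X X) a' = a"
      using transpose_surj[OF a D.Prod_Ob[OF X X]] .
    obtain b' where b': "b' \<in> Hom D (FOb F A) (Prod D X X)" "\<phi> A (Prod D X X) b' = b"
      using transpose_surj[OF b D.Prod_Ob[OF X X]] .
    have "\<phi> A X (pr1 D X X \<cdot>\<^bsub>D\<^esub> a') = \<phi> A X (pr1 D X X \<cdot>\<^bsub>D\<^esub> b')"
      "\<phi> A X (pr2 D X X \<cdot>\<^bsub>D\<^esub> a') = \<phi> A X (pr2 D X X \<cdot>\<^bsub>D\<^esub> b')"
      unfolding transpose_Comp[OF A a'(1) p(1)] transpose_Comp[OF A a'(1) p(2)]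
        transpose_Comp[OF A b'(1) p(1)] transpose_Comp[OF A b'(1) p(2)] a'(2) b'(2) by (fact eq)+
    then have "pr1 D X X \<cdot>\<^bsub>D\<^esub> a' = pr1 D X X \<cdot>\<^bsub>D\<^esub> b'" "pr2 D X X \<cdot>\<^bsub>D\<^esub> a' = pr2 D X X \<cdot>\<^bsub>D\<^esub> b'"
      using transpose_inj[OF A D.Comp_Hom[OF a'(1) p(1)] D.Comp_Hom[OF b'(1) p(1)]]
        transpose_inj[OF A D.Comp_Hom[OF a'(1) p(2)] D.Comp_Hom[OF b'(1) p(2)]] by simp_all
    then have "a' = b'" by (rule D.product_eqI[OF X X a'(1) b'(1)])
    then show ?thesis using a' b' by simp
  qed
  show ?thesis
  proof (rule C.isoI[OF cmp(1) c'])
    show "c' \<cdot>\<^bsub>C\<^esub> comparison D C G X = Id C (FOb G (Prod D X X))"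
      by (rule jointly_monic[OF C.Comp_Hom[OF cmp(1) c'] C.Id_Hom[OF G_simps(1)[OF D.Prod_Ob[OF X X]]]])
        (simp_all add: C.Comp_assoc[OF cmp(1) c' G_simps(2)[OF p(1)], symmetric]
          C.Comp_assoc[OF cmp(1) c' G_simps(2)[OF p(2)], symmetric] Gp_c' cmp(2,3)
          C.Comp_Id[OF G_simps(2)[OF p(1)]] C.Comp_Id[OF G_simps(2)[OF p(2)]]
          del: C.Comp_assoc_Ar)
    show "comparison D C G X \<cdot>\<^bsub>C\<^esub> c' = Id C P"
      by (rule C.product_eqI[OF GX GX, folded P_def, OF C.Comp_Hom[OF c' cmp(1)] C.Id_Hom[OF P_Ob]])
        (simp_all add: C.Comp_assoc[OF c' cmp(1) P_pr(1), symmetric]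
          C.Comp_assoc[OF c' cmp(1) P_pr(2), symmetric] Gp_c' cmp(2,3)
          C.Comp_Id[OF P_pr(1)] C.Comp_Id[OF P_pr(2)]
          del: C.Comp_assoc_Ar)
  qed
qed

section \<open>Images of relations under the two functors\<close>

lemma is_rel_image_G:
  assumes X: "X \<in> Ob D" and r: "is_rel D MD X X r"
  shows "is_rel C MC (FOb G X) (FOb G X) (image_rel D C G X r)"
proof -
  note rD = D.is_relD[OF r X]
  have "comparison D C G X \<in> MC" using comparison_G_iso[OF X] C.E_Int_M by blast
  moreover have "Cod C (FAr G r) = Dom C (comparison D C G X)"
    using C.Hom_Cod[OF G_simps(2)[OF rD(2)]]
      C.Hom_Dom[OF C.tuple(1)[OF G_simps(2)[OF D.pr1_Hom[OF X X]] G_simps(2)[OF D.pr2_Hom[OF X X]]]]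
    by (simp add: comparison_def)
  ultimately have "image_rel D C G X r \<in> MC"
    unfolding image_rel_def using C.M_comp[OF G_M[OF rD(1)]] by blast
  then show ?thesis using C.Hom_Cod[OF image_G(1)[OF X rD(2)]] by (simp add: is_rel_def)
qed

lemma is_rel_image_F:
  assumes S: "S \<in> Ob C" and q: "is_rel C MC S S q"
  shows "is_rel D MD (FOb F S) (FOb F S) (image_rel C D F S q)"
proof -
  note qD = C.is_relD[OF q S]
  have "Cod D (FAr F q) = Dom D (comparison C D F S)"
    using D.Hom_Cod[OF F_simps(2)[OF qD(2)]]
      D.Hom_Dom[OF D.tuple(1)[OF F_simps(2)[OF C.pr1_Hom[OF S S]] F_simps(2)[OF C.pr2_Hom[OF S S]]]]
    by (simp add: comparison_def)
  then have "image_rel C D F S q \<in> MD"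
    unfolding image_rel_def using D.M_comp[OF F_M[OF qD(1)] comparison_F_M[OF S]] by blast
  then show ?thesis using D.Hom_Cod[OF image_F(1)[OF S qD(2)]] by (simp add: is_rel_def)
qed

text \<open>A witness \<open>d\<close> from \<open>S\<close> into \<open>G\<close> of the domain of
  \<open>r\<close> is the transpose of some \<open>c\<close> from \<open>FS\<close> into that
  domain. By naturality the legs applied to \<open>d\<close> are the transposes of the legs applied
  to \<open>c\<close>, and injectivity of \<open>\<phi>\<close> cancels the transposition.\<close>

lemma related_transpose:
  assumes S: "S \<in> Ob C" and X: "X \<in> Ob D" and r: "is_rel D MD X X r"
    and u: "u \<in> Hom D (FOb F S) X" and v: "v \<in> Hom D (FOb F S) X"
  shows "related C (image_rel D C G X r) (\<phi> S X u) (\<phi> S X v) \<longleftrightarrow> related D r u v"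
proof -
  note rD = D.is_relD[OF r X] and GX = G_simps(1)[OF X]
  note im = image_G[OF X rD(2)]
  have legs: "\<phi> S X ((pr1 D X X \<cdot>\<^bsub>D\<^esub> r) \<cdot>\<^bsub>D\<^esub> c) = \<phi> S X u \<longleftrightarrow> (pr1 D X X \<cdot>\<^bsub>D\<^esub> r) \<cdot>\<^bsub>D\<^esub> c = u"
    "\<phi> S X ((pr2 D X X \<cdot>\<^bsub>D\<^esub> r) \<cdot>\<^bsub>D\<^esub> c) = \<phi> S X v \<longleftrightarrow> (pr2 D X X \<cdot>\<^bsub>D\<^esub> r) \<cdot>\<^bsub>D\<^esub> c = v"
    if "c \<in> Hom D (FOb F S) (Dom D r)" for c
    using transpose_inj[OF S D.Comp_Hom[OF that rD(3)] u] transpose_inj[OF S D.Comp_Hom[OF that rD(4)] v]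
    by auto
  have "related C (image_rel D C G X r) (\<phi> S X u) (\<phi> S X v) \<longleftrightarrow>
    (\<exists>d \<in> Hom C S (FOb G (Dom D r)). FAr G (pr1 D X X \<cdot>\<^bsub>D\<^esub> r) \<cdot>\<^bsub>C\<^esub> d = \<phi> S X u \<and>
       FAr G (pr2 D X X \<cdot>\<^bsub>D\<^esub> r) \<cdot>\<^bsub>C\<^esub> d = \<phi> S X v)"
    using C.related_iff[OF GX im(1) transpose_Hom[OF S u] transpose_Hom[OF S v]] im(2,3) by simp
  also have "Hom C S (FOb G (Dom D r)) = \<phi> S (Dom D r) ` Hom D (FOb F S) (Dom D r)"
    using transpose_bij[OF S D.Hom_Ob(1)[OF rD(2)]] by (simp add: bij_betw_def)
  also have "(\<exists>d \<in> \<phi> S (Dom D r) ` Hom D (FOb F S) (Dom D r). FAr G (pr1 D X X \<cdot>\<^bsub>D\<^esub> r) \<cdot>\<^bsub>C\<^esub> d = \<phi> S X u \<and>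
       FAr G (pr2 D X X \<cdot>\<^bsub>D\<^esub> r) \<cdot>\<^bsub>C\<^esub> d = \<phi> S X v) \<longleftrightarrow>
    (\<exists>c \<in> Hom D (FOb F S) (Dom D r). (pr1 D X X \<cdot>\<^bsub>D\<^esub> r) \<cdot>\<^bsub>D\<^esub> c = u \<and> (pr2 D X X \<cdot>\<^bsub>D\<^esub> r) \<cdot>\<^bsub>D\<^esub> c = v)"
    unfolding bex_simps
    by (intro bex_cong refl)
      (simp add: transpose_Comp[OF S _ rD(3), symmetric] transpose_Comp[OF S _ rD(4), symmetric] legs
        del: D.Comp_assoc_Ar)
  also have "\<dots> \<longleftrightarrow> related D r u v" using D.related_iff[OF X rD(2) u v] by simp
  finally show ?thesis .
qed

text \<open>Both laws are those of \<open>r\<close> read at the stages \<open>FOb F A\<close>; this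
  is why no closure is taken on this side.\<close>

lemma is_preorder_image_G:
  assumes X: "X \<in> Ob D" and r: "is_preorder D ED MD X r"
  shows "is_preorder C EC MC (FOb G X) (image_rel D C G X r)"
proof -
  have rel: "is_rel D MD X X r" using r by (simp add: is_preorder_def)
  note r = r[unfolded D.is_preorder_iff[OF X rel]]
  show ?thesis
    unfolding C.is_preorder_iff[OF G_simps(1)[OF X] is_rel_image_G[OF X rel]]
  proof (intro conjI allI ballI impI)
    fix A x assume x: "x \<in> Hom C A (FOb G X)"
    obtain x' where x': "x' \<in> Hom D (FOb F A) X" "\<phi> A X x' = x" using transpose_surj[OF x X] .
    show "related C (image_rel D C G X r) x x"
      using related_transpose[OF C.Hom_Ob(1)[OF x] X rel x'(1) x'(1)] r x' by blast
    fix y z assume y: "y \<in> Hom C A (FOb G X)" and z: "z \<in> Hom C A (FOb G X)"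
      and rels: "related C (image_rel D C G X r) x y" "related C (image_rel D C G X r) y z"
    obtain y' where y': "y' \<in> Hom D (FOb F A) X" "\<phi> A X y' = y" using transpose_surj[OF y X] .
    obtain z' where z': "z' \<in> Hom D (FOb F A) X" "\<phi> A X z' = z" using transpose_surj[OF z X] .
    note tr = related_transpose[OF C.Hom_Ob(1)[OF x] X rel]
    have "related D r x' y'" "related D r y' z'"
      using rels tr[OF x'(1) y'(1)] tr[OF y'(1) z'(1)] x'(2) y'(2) z'(2) by simp_all
    then have "related D r x' z'" using r x'(1) y'(1) z'(1) by blast
    then show "related C (image_rel D C G X r) x z"
      using tr[OF x'(1) z'(1)] x'(2) z'(2) by simp
  qed
qed

text \<open>Reflexivity of \<open>q\<close> amounts to an arrow \<open>d\<close> whose composites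
  with both legs are the identity of \<open>S\<close>. A functor keeps these equations, so the image
  of \<open>q\<close> is reflexive, and \<open>c\<close> contains it.\<close>

lemma is_preorder_closure_image_F:
  assumes S: "S \<in> Ob C" and q: "is_preorder C EC MC S q"
    and c: "is_rel D MD (FOb F S) (FOb F S) c" "transitive_rel D ED MD (FOb F S) c"
      "factors_through D (image_rel C D F S q) c"
  shows "is_preorder D ED MD (FOb F S) c"
proof -
  have rel: "is_rel C MC S S q" using q by (simp add: is_preorder_def)
  note FS = F_simps(1)[OF S] and qD = C.is_relD[OF rel S] and I = D.Id_Hom[OF F_simps(1)[OF S]]
  have "related C q (Id C S) (Id C S)"
    using q C.is_preorder_iff[OF S rel] C.Id_Hom[OF S] by blast
  then obtain d where d: "d \<in> Hom C S (Dom C q)" "(pr1 C S S \<cdot>\<^bsub>C\<^esub> q) \<cdot>\<^bsub>C\<^esub> d = Id C S"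
    "(pr2 C S S \<cdot>\<^bsub>C\<^esub> q) \<cdot>\<^bsub>C\<^esub> d = Id C S"
    unfolding C.related_iff[OF S qD(2) C.Id_Hom[OF S] C.Id_Hom[OF S]] by blast
  have "related D (image_rel C D F S q) (Id D (FOb F S)) (Id D (FOb F S))"
    unfolding D.related_iff[OF FS image_F(1)[OF S qD(2)] I I] image_F(2,3)[OF S qD(2)]
    using F_simps(2)[OF d(1)] F_simps(4)[OF d(1) qD(3)] F_simps(4)[OF d(1) qD(4)] d(2,3) F_simps(3)[OF S]
    by auto
  then have "reflexive_rel D (FOb F S) c"
    using D.related_mono[OF _ c(3)] c(1) by (simp add: is_rel_def reflexive_rel_def diagonal_def related_def)
  then show ?thesis using c by (simp add: is_preorder_def)
qed

text \<open>The representative picked by \<open>SOME\<close> has an image equivalent to that of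
  \<open>q\<close>, and equivalent relations are contained in the same transitive relations; the two
  meets are taken over the same family.\<close>

lemma left_ob_eq:
  assumes S: "S \<in> Ob C" and q: "is_rel C MC S S q"
  shows "left_ob (S, sub_class C MC q) =
    (FOb F S, transitive_closure D ED MD (FOb F S) (image_rel C D F S q))"
proof -
  define q' where "q' = (SOME q'. q' \<in> sub_class C MC q)"
  note qD = C.is_relD[OF q S]
  have q': "q' \<in> sub_class C MC q"
    unfolding q'_def by (rule someI[of "\<lambda>q'. q' \<in> sub_class C MC q", OF C.sub_class_self[OF qD(1)]])
  then have q'_rel: "is_rel C MC S S q'" using C.sub_classD(1,2)[OF q'] q by (simp add: is_rel_def)
  have le: "factors_through D (image_rel C D F S q) (image_rel C D F S q')"
    "factors_through D (image_rel C D F S q') (image_rel C D F S q)"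
    using image_rel_mono[OF rel_cats functor_F S] qD(2) C.is_relD(2)[OF q'_rel S] C.sub_classD(3,4)[OF q']
    by blast+
  have "factors_through D (image_rel C D F S q') t \<longleftrightarrow> factors_through D (image_rel C D F S q) t"
    if "is_rel D MD (FOb F S) (FOb F S) t" for t
    using that D.factors_through_trans[OF le(1), of t] D.factors_through_trans[OF le(2), of t] D.M_in_Ar
    by (auto simp: is_rel_def)
  then have "transitive_closure D ED MD (FOb F S) (image_rel C D F S q') =
      transitive_closure D ED MD (FOb F S) (image_rel C D F S q)"
    unfolding transitive_closure_def by (simp cong: conj_cong)
  then show ?thesis by (simp add: Ord_left_ob_def q'_def[symmetric])
qed

lemma right_ob_eq:
  assumes X: "X \<in> Ob D" and r: "is_rel D MD X X r"
  shows "right_ob (X, sub_class D MD r) = (FOb G X, sub_class C MC (image_rel D C G X r))"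
proof -
  define r' where "r' = (SOME r'. r' \<in> sub_class D MD r)"
  note rD = D.is_relD[OF r X]
  have r': "r' \<in> sub_class D MD r"
    unfolding r'_def by (rule someI[of "\<lambda>r'. r' \<in> sub_class D MD r", OF D.sub_class_self[OF rD(1)]])
  then have r'_rel: "is_rel D MD X X r'" using D.sub_classD(1,2)[OF r'] r by (simp add: is_rel_def)
  have "factors_through C (image_rel D C G X r) (image_rel D C G X r')"
    "factors_through C (image_rel D C G X r') (image_rel D C G X r)"
    using image_rel_mono[OF rel_cats(2,1) functor_G X] rD(2) D.is_relD(2)[OF r'_rel X] D.sub_classD(3,4)[OF r']
    by blast+
  then have "sub_class C MC (image_rel D C G X r') = sub_class C MC (image_rel D C G X r)"
    using C.sub_class_eqI is_rel_image_G[OF X r] is_rel_image_G[OF X r'_rel] by (simp add: is_rel_def)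
  then show ?thesis by (simp add: Ord_right_ob_def r'_def[symmetric])
qed

lemma left_ob_in_ord_objects:
  assumes "P \<in> ord_objects C EC MC"
  shows "left_ob P \<in> ord_objects D ED MD" "fst (left_ob P) = FOb F (fst P)"
proof -
  obtain S q where q: "P = (S, sub_class C MC q)" "S \<in> Ob C" "is_preorder C EC MC S q" "is_rel C MC S S q"
    using C.ord_objects_cases[OF assms] .
  obtain c where c: "is_rel D MD (FOb F S) (FOb F S) c"
    "transitive_closure D ED MD (FOb F S) (image_rel C D F S q) = sub_class D MD c"
    "factors_through D (image_rel C D F S q) c" "transitive_rel D ED MD (FOb F S) c"
    using D.transitive_closure_exists[OF F_simps(1)[OF q(2)] is_rel_image_F[OF q(2,4)]] by metis
  show "left_ob P \<in> ord_objects D ED MD" "fst (left_ob P) = FOb F (fst P)"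
    unfolding q(1) left_ob_eq[OF q(2,4)] c(2)
    using D.ord_objects_I[OF F_simps(1)[OF q(2)] is_preorder_closure_image_F[OF q(2,3) c(1,4,3)]] by simp_all
qed

lemma right_ob_in_ord_objects:
  assumes "P \<in> ord_objects D ED MD"
  shows "right_ob P \<in> ord_objects C EC MC" "fst (right_ob P) = FOb G (fst P)"
proof -
  obtain X r where r: "P = (X, sub_class D MD r)" "X \<in> Ob D" "is_preorder D ED MD X r" "is_rel D MD X X r"
    using D.ord_objects_cases[OF assms] .
  show "right_ob P \<in> ord_objects C EC MC" "fst (right_ob P) = FOb G (fst P)"
    unfolding r(1) right_ob_eq[OF r(2,4)]
    using C.ord_objects_I[OF G_simps(1)[OF r(2)] is_preorder_image_G[OF r(2,3)]] by simp_all
qed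

text \<open>\<open>h\<close> is monotone on the closure of \<open>FQ\<close> iff its inverse image of \<open>R\<close>, a transitive relation,
  contains \<open>FQ\<close>; this says that \<open>R\<close> relates the composites of \<open>h\<close> with the two legs of \<open>FQ\<close>, whose
  transposes are the composites of \<open>\<phi> h\<close> with the legs of \<open>Q\<close>.\<close>

lemma monotone_transpose_iff:
  assumes P: "P \<in> ord_objects C EC MC" and Q: "Q \<in> ord_objects D ED MD"
    and h: "h \<in> Hom D (FOb F (fst P)) (fst Q)"
  shows "monotone_arrow C P (\<phi> (fst P) (fst Q) h) (right_ob Q) \<longleftrightarrow> monotone_arrow D (left_ob P) h Q"
proof -
  obtain S q where q: "P = (S, sub_class C MC q)" "S \<in> Ob C" "is_preorder C EC MC S q" "is_rel C MC S S q"
    using C.ord_objects_cases[OF P] .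
  obtain X r where r: "Q = (X, sub_class D MD r)" "X \<in> Ob D" "is_preorder D ED MD X r" "is_rel D MD X X r"
    using D.ord_objects_cases[OF Q] .
  have h: "h \<in> Hom D (FOb F S) X" using h q(1) r(1) by simp
  note S = q(2) and X = r(2) and FS = F_simps(1)[OF q(2)] and qD = C.is_relD[OF q(4) q(2)]
  note im = is_rel_image_F[OF S q(4)]
  note im_legs = image_F[OF S qD(2)]
  obtain c where c: "is_rel D MD (FOb F S) (FOb F S) c"
    "transitive_closure D ED MD (FOb F S) (image_rel C D F S q) = sub_class D MD c"
    "factors_through D (image_rel C D F S q) c"
    "\<And>p. is_rel D MD (FOb F S) (FOb F S) p \<Longrightarrow> factors_through D (image_rel C D F S q) p \<Longrightarrow>
       transitive_rel D ED MD (FOb F S) p \<Longrightarrow> factors_through D c p"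
    using D.transitive_closure_exists[OF FS im] by metis
  obtain p where p: "is_rel D MD (FOb F S) (FOb F S) p"
    "\<And>A x y. x \<in> Hom D A (FOb F S) \<Longrightarrow> y \<in> Hom D A (FOb F S) \<Longrightarrow>
      related D p x y \<longleftrightarrow> related D r (h \<cdot>\<^bsub>D\<^esub> x) (h \<cdot>\<^bsub>D\<^esub> y)"
    using D.inverse_image[OF h r(4)] by metis
  have "transitive_rel D ED MD (FOb F S) p"
    unfolding D.transitive_rel_iff[OF FS p(1)]
  proof (intro allI ballI impI)
    fix A x y z
    assume xyz: "x \<in> Hom D A (FOb F S)" "y \<in> Hom D A (FOb F S)" "z \<in> Hom D A (FOb F S)"
      and rels: "related D p x y" "related D p y z"
    have "related D r (h \<cdot>\<^bsub>D\<^esub> x) (h \<cdot>\<^bsub>D\<^esub> y)" "related D r (h \<cdot>\<^bsub>D\<^esub> y) (h \<cdot>\<^bsub>D\<^esub> z)"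
      using rels p(2) xyz by blast+
    then have "related D r (h \<cdot>\<^bsub>D\<^esub> x) (h \<cdot>\<^bsub>D\<^esub> z)"
      using r(3)[unfolded D.is_preorder_iff[OF X r(4)]] xyz[THEN D.Comp_Hom, OF h] by blast
    then show "related D p x z" using p(2) xyz by blast
  qed
  then have c_le_p: "factors_through D c p \<longleftrightarrow> factors_through D (image_rel C D F S q) p"
    using c(4)[OF p(1)] D.factors_through_trans[OF c(3), of p] p(1) D.M_in_Ar by (auto simp: is_rel_def)
  have "monotone_arrow D (left_ob P) h Q \<longleftrightarrow> factors_through D c p"
    unfolding q(1) r(1) left_ob_eq[OF S q(4)] c(2) D.monotone_arrow_iff[OF FS X c(1) r(4)]
      D.sub_rel_iff[OF FS c(1) p(1)]
    using h p(2) by simp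
  also have "\<dots> \<longleftrightarrow> related D p (FAr F (pr1 C S S \<cdot>\<^bsub>C\<^esub> q)) (FAr F (pr2 C S S \<cdot>\<^bsub>C\<^esub> q))"
    unfolding c_le_p D.factors_through_iff_related[OF FS im_legs(1)] im_legs(2,3) ..
  also have "\<dots> \<longleftrightarrow> related D r (h \<cdot>\<^bsub>D\<^esub> FAr F (pr1 C S S \<cdot>\<^bsub>C\<^esub> q)) (h \<cdot>\<^bsub>D\<^esub> FAr F (pr2 C S S \<cdot>\<^bsub>C\<^esub> q))"
    by (rule p(2)[OF F_simps(2)[OF qD(3)] F_simps(2)[OF qD(4)]])
  also have "\<dots> \<longleftrightarrow> related C (image_rel D C G X r)
      (\<phi> S X h \<cdot>\<^bsub>C\<^esub> (pr1 C S S \<cdot>\<^bsub>C\<^esub> q)) (\<phi> S X h \<cdot>\<^bsub>C\<^esub> (pr2 C S S \<cdot>\<^bsub>C\<^esub> q))"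
    unfolding transpose_Comp_F[OF qD(3) h, symmetric] transpose_Comp_F[OF qD(4) h, symmetric]
    by (rule related_transpose[OF C.Hom_Ob(1)[OF qD(2)] X r(4) D.Comp_Hom[OF F_simps(2)[OF qD(3)] h]
          D.Comp_Hom[OF F_simps(2)[OF qD(4)] h], symmetric])
  also have "\<dots> \<longleftrightarrow> monotone_arrow C P (\<phi> (fst P) (fst Q) h) (right_ob Q)"
    unfolding q(1) r(1) fst_conv right_ob_eq[OF X r(4)]
      C.monotone_arrow_iff_legs[OF S G_simps(1)[OF X] q(4) is_rel_image_G[OF X r(4)]]
    using transpose_Hom[OF S h] by simp
  finally show ?thesis ..
qed

section \<open>The lifted functors and their adjunction\<close>

lemma ord_objects_fst: "P \<in> ord_objects C EC MC \<Longrightarrow> fst P \<in> Ob C"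
  "Q \<in> ord_objects D ED MD \<Longrightarrow> fst Q \<in> Ob D"
  by (auto simp: ord_objects_def)

text \<open>The unit \<open>?\<eta>\<close> is monotone as the transpose of an identity, and
  composing it with \<open>g\<close> gives the transpose of \<open>FAr F g\<close>. This avoids
  comparing the two closures directly.\<close>

lemma monotone_F:
  assumes P: "P \<in> ord_objects C EC MC" and P': "P' \<in> ord_objects C EC MC" and g: "monotone_arrow C P g P'"
  shows "monotone_arrow D (left_ob P) (FAr F g) (left_ob P')"
proof -
  note gH = C.monotone_arrow_Hom[OF g]
  note L' = left_ob_in_ord_objects[OF P']
  note I = D.Id_Hom[OF F_simps(1)[OF ord_objects_fst(1)[OF P']]]
  let ?\<eta> = "\<phi> (fst P') (FOb F (fst P')) (Id D (FOb F (fst P')))"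
  have "monotone_arrow C P' ?\<eta> (right_ob (left_ob P'))"
    using monotone_transpose_iff[OF P' L'(1)] D.monotone_arrow_Id[OF L'(1)] I L'(2) by simp
  then have "monotone_arrow C P (?\<eta> \<cdot>\<^bsub>C\<^esub> g) (right_ob (left_ob P'))"
    by (rule C.monotone_arrow_Comp[OF P P' right_ob_in_ord_objects(1)[OF L'(1)] g])
  moreover have "?\<eta> \<cdot>\<^bsub>C\<^esub> g = \<phi> (fst P) (FOb F (fst P')) (FAr F g)"
    using transpose_Comp_F[OF gH I] D.Id_Comp[OF F_simps(2)[OF gH]] by simp
  ultimately show ?thesis
    using monotone_transpose_iff[OF P L'(1), of "FAr F g"] F_simps(2)[OF gH] L'(2) by simp
qed

text \<open>Dually, the counit \<open>\<epsilon>\<close> is monotone because its transpose is an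
  identity, and \<open>FAr G f\<close> is the transpose of \<open>f\<close> composed with
  \<open>\<epsilon>\<close>.\<close>

lemma monotone_G:
  assumes Q: "Q \<in> ord_objects D ED MD" and Q': "Q' \<in> ord_objects D ED MD" and f: "monotone_arrow D Q f Q'"
  shows "monotone_arrow C (right_ob Q) (FAr G f) (right_ob Q')"
proof -
  note fH = D.monotone_arrow_Hom[OF f]
  note R = right_ob_in_ord_objects[OF Q]
  note GX = G_simps(1)[OF ord_objects_fst(2)[OF Q]]
  obtain \<epsilon> where \<epsilon>: "\<epsilon> \<in> Hom D (FOb F (FOb G (fst Q))) (fst Q)"
    "\<phi> (FOb G (fst Q)) (fst Q) \<epsilon> = Id C (FOb G (fst Q))"
    using transpose_surj[OF C.Id_Hom[OF GX] ord_objects_fst(2)[OF Q]] .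
  have "monotone_arrow D (left_ob (right_ob Q)) \<epsilon> Q"
    using monotone_transpose_iff[OF R(1) Q, of \<epsilon>] C.monotone_arrow_Id[OF R(1)] \<epsilon> R(2) by simp
  then have "monotone_arrow D (left_ob (right_ob Q)) (f \<cdot>\<^bsub>D\<^esub> \<epsilon>) Q'"
    using D.monotone_arrow_Comp[OF left_ob_in_ord_objects(1)[OF R(1)] Q Q' _ f] by blast
  moreover have "\<phi> (FOb G (fst Q)) (fst Q') (f \<cdot>\<^bsub>D\<^esub> \<epsilon>) = FAr G f"
    using transpose_Comp[OF GX \<epsilon>(1) fH] \<epsilon>(2) C.Comp_Id[OF G_simps(2)[OF fH]] by simp
  ultimately show ?thesis
    using monotone_transpose_iff[OF R(1) Q', of "f \<cdot>\<^bsub>D\<^esub> \<epsilon>"] D.Comp_Hom[OF \<epsilon>(1) fH] R(2) by simp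
qed

lemma is_functor_Ord_left: "is_functor (Ord C EC MC) (Ord D ED MD) (Ord_left C D ED MD F)"
  unfolding is_functor_def
proof (intro conjI allI ballI)
  show "category (Ord C EC MC)" "category (Ord D ED MD)" by (fact C.category_Ord D.category_Ord)+
  show "FOb (Ord_left C D ED MD F) P \<in> Ob (Ord D ED MD)" if "P \<in> Ob (Ord C EC MC)" for P
    using that left_ob_in_ord_objects(1)[of P] by (simp add: Ord_def Ord_left_def)
  show "FAr (Ord_left C D ED MD F) f \<in>
      Hom (Ord D ED MD) (FOb (Ord_left C D ED MD F) P) (FOb (Ord_left C D ED MD F) Q)"
    if "f \<in> Hom (Ord C EC MC) P Q" for P Q f
    using that monotone_F[of P Q] left_ob_in_ord_objects(1)[of P] left_ob_in_ord_objects(1)[of Q]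
    by (auto simp: C.Hom_Ord D.Hom_Ord Ord_left_def)
  show "FAr (Ord_left C D ED MD F) (Id (Ord C EC MC) P) = Id (Ord D ED MD) (FOb (Ord_left C D ED MD F) P)"
    if "P \<in> Ob (Ord C EC MC)" for P
    using that left_ob_in_ord_objects(2)[of P] F_simps(3)[OF ord_objects_fst(1), of P]
    by (simp add: Ord_def Ord_left_def)
  show "FAr (Ord_left C D ED MD F) (Comp (Ord C EC MC) g f) =
      Comp (Ord D ED MD) (FAr (Ord_left C D ED MD F) g) (FAr (Ord_left C D ED MD F) f)"
    if "f \<in> Hom (Ord C EC MC) P Q" "g \<in> Hom (Ord C EC MC) Q R" for P Q R f g
    using that F_simps(4)[OF C.monotone_arrow_Hom[of P _ Q] C.monotone_arrow_Hom[of Q _ R]]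
    by (auto simp: C.Hom_Ord) (simp add: Ord_def Ord_left_def)
qed

lemma is_functor_Ord_right: "is_functor (Ord D ED MD) (Ord C EC MC) (Ord_right C D MC G)"
  unfolding is_functor_def
proof (intro conjI allI ballI)
  show "category (Ord D ED MD)" "category (Ord C EC MC)" by (fact C.category_Ord D.category_Ord)+
  show "FOb (Ord_right C D MC G) P \<in> Ob (Ord C EC MC)" if "P \<in> Ob (Ord D ED MD)" for P
    using that right_ob_in_ord_objects(1)[of P] by (simp add: Ord_def Ord_right_def)
  show "FAr (Ord_right C D MC G) f \<in>
      Hom (Ord C EC MC) (FOb (Ord_right C D MC G) P) (FOb (Ord_right C D MC G) Q)"
    if "f \<in> Hom (Ord D ED MD) P Q" for P Q f
    using that monotone_G[of P Q] right_ob_in_ord_objects(1)[of P] right_ob_in_ord_objects(1)[of Q]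
    by (auto simp: C.Hom_Ord D.Hom_Ord Ord_right_def)
  show "FAr (Ord_right C D MC G) (Id (Ord D ED MD) P) = Id (Ord C EC MC) (FOb (Ord_right C D MC G) P)"
    if "P \<in> Ob (Ord D ED MD)" for P
    using that right_ob_in_ord_objects(2)[of P] G_simps(3)[OF ord_objects_fst(2), of P]
    by (simp add: Ord_def Ord_right_def)
  show "FAr (Ord_right C D MC G) (Comp (Ord D ED MD) g f) =
      Comp (Ord C EC MC) (FAr (Ord_right C D MC G) g) (FAr (Ord_right C D MC G) f)"
    if "f \<in> Hom (Ord D ED MD) P Q" "g \<in> Hom (Ord D ED MD) Q R" for P Q R f g
    using that G_simps(4)[OF D.monotone_arrow_Hom[of P _ Q] D.monotone_arrow_Hom[of Q _ R]]
    by (auto simp: D.Hom_Ord) (simp add: Ord_def Ord_right_def)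
qed

text \<open>By \<open>monotone_transpose_iff\<close> the bijection \<open>\<phi>\<close> restricts
  to monotone arrows. Naturality is inherited, since composition in \<open>Ord\<close> is that of
  the underlying arrows.\<close>

lemma adjoint_Ord:
  "adjoint (Ord C EC MC) (Ord D ED MD) (Ord_left C D ED MD F) (Ord_right C D MC G)"
  unfolding adjoint_def
proof (intro exI conjI ballI)
  \<comment> \<open>Only the middle component is transposed; the outer ones are the domain and
    codomain that the resulting arrow of \<open>Ord C EC MC\<close> has to carry.\<close>
  let ?\<psi> = "\<lambda>P Q (u :: ('od, 'ad) ord_ar). (P, \<phi> (fst P) (fst Q) (fst (snd u)), right_ob Q)"
  fix P Q assume "P \<in> Ob (Ord C EC MC)" "Q \<in> Ob (Ord D ED MD)"
  then have P: "P \<in> ord_objects C EC MC" and Q: "Q \<in> ord_objects D ED MD" by (simp_all add: Ord_def)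
  note L = left_ob_in_ord_objects[OF P] and R = right_ob_in_ord_objects[OF Q]
  have homD: "Hom (Ord D ED MD) (FOb (Ord_left C D ED MD F) P) Q =
      (\<lambda>h. (left_ob P, h, Q)) ` {h. monotone_arrow D (left_ob P) h Q}"
    using L(1) Q by (auto simp: D.Hom_Ord Ord_left_def)
  have homC: "Hom (Ord C EC MC) P (FOb (Ord_right C D MC G) Q) =
      (\<lambda>k. (P, k, right_ob Q)) ` {k. monotone_arrow C P k (right_ob Q)}"
    using R(1) P by (auto simp: C.Hom_Ord Ord_right_def)
  have monoD: "h \<in> Hom D (FOb F (fst P)) (fst Q)" if "monotone_arrow D (left_ob P) h Q" for h
    using D.monotone_arrow_Hom[OF that] L(2) by simp
  have "bij_betw (\<phi> (fst P) (fst Q)) {h. monotone_arrow D (left_ob P) h Q} {k. monotone_arrow C P k (right_ob Q)}"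
    unfolding bij_betw_def
  proof (intro conjI equalityI subsetI)
    show "inj_on (\<phi> (fst P) (fst Q)) {h. monotone_arrow D (left_ob P) h Q}"
      using transpose_inj[OF ord_objects_fst(1)[OF P] monoD monoD] by (auto simp: inj_on_def)
    show "k \<in> {k. monotone_arrow C P k (right_ob Q)}"
      if "k \<in> \<phi> (fst P) (fst Q) ` {h. monotone_arrow D (left_ob P) h Q}" for k
      using that monotone_transpose_iff[OF P Q monoD] by blast
    fix k assume "k \<in> {k. monotone_arrow C P k (right_ob Q)}"
    then have k: "monotone_arrow C P k (right_ob Q)" by simp
    then have "k \<in> Hom C (fst P) (FOb G (fst Q))" using C.monotone_arrow_Hom R(2) by metis
    then obtain h where h: "h \<in> Hom D (FOb F (fst P)) (fst Q)" "\<phi> (fst P) (fst Q) h = k"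
      using transpose_surj[OF _ ord_objects_fst(2)[OF Q]] by blast
    then have "monotone_arrow D (left_ob P) h Q" using monotone_transpose_iff[OF P Q h(1)] k by simp
    then show "k \<in> \<phi> (fst P) (fst Q) ` {h. monotone_arrow D (left_ob P) h Q}" using h(2) by blast
  qed
  then show "bij_betw (?\<psi> P Q) (Hom (Ord D ED MD) (FOb (Ord_left C D ED MD F) P) Q)
      (Hom (Ord C EC MC) P (FOb (Ord_right C D MC G) Q))"
    unfolding homC homD by (auto simp: bij_betw_def inj_on_def image_image)
next
  let ?\<psi> = "\<lambda>P Q (u :: ('od, 'ad) ord_ar). (P, \<phi> (fst P) (fst Q) (fst (snd u)), right_ob Q)"
  fix P P' Q Q' s x h
  assume s: "s \<in> Hom (Ord C EC MC) P' P" and x: "x \<in> Hom (Ord D ED MD) Q Q'"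
    and h: "h \<in> Hom (Ord D ED MD) (FOb (Ord_left C D ED MD F) P) Q"
  have P: "P \<in> ord_objects C EC MC" using s by (auto simp: C.Hom_Ord)
  obtain s' where s': "s = (P', s', P)" "s' \<in> Hom C (fst P') (fst P)"
    using s C.monotone_arrow_Hom[of P' _ P] by (auto simp: C.Hom_Ord)
  obtain x' where x': "x = (Q, x', Q')" "x' \<in> Hom D (fst Q) (fst Q')"
    using x D.monotone_arrow_Hom[of Q _ Q'] by (auto simp: D.Hom_Ord)
  obtain h' where h': "h = (left_ob P, h', Q)" "h' \<in> Hom D (FOb F (fst P)) (fst Q)"
    using h D.monotone_arrow_Hom[of "left_ob P" _ Q] left_ob_in_ord_objects(2)[OF P]
    by (auto simp: D.Hom_Ord Ord_left_def)
  show "?\<psi> P' Q' (x \<cdot>\<^bsub>Ord D ED MD\<^esub> h \<cdot>\<^bsub>Ord D ED MD\<^esub> FAr (Ord_left C D ED MD F) s) =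
      FAr (Ord_right C D MC G) x \<cdot>\<^bsub>Ord C EC MC\<^esub> ?\<psi> P Q h \<cdot>\<^bsub>Ord C EC MC\<^esub> s"
    unfolding s'(1) x'(1) h'(1)
    using transpose_natural[OF s'(2) x'(2) h'(2)] by (simp add: Ord_def Ord_left_def Ord_right_def)
qed

end

theorem theoremD43:
  fixes C :: "('oc, 'ac) cat" and D :: "('od, 'ad) cat"
    and F :: "('oc, 'ac, 'od, 'ad) funct" and G :: "('od, 'ad, 'oc, 'ac) funct"
    and EC MC :: "'ac set" and ED MD :: "'ad set"
  assumes universe: "uncountable (UNIV :: 'u set)"
    and functor_F: "is_functor C D F"
    and functor_G: "is_functor D C G"
    and adj: "adjoint C D F G"
    and ofs_C: "factorisation_system C EC MC"
    and ofs_D: "factorisation_system D ED MD"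
    and A1: "well_powered TYPE('u) C MC" "well_powered TYPE('u) D MD"
    and A2: "has_small_limits TYPE('u) C" "has_small_limits TYPE('u) D"
    and A3: "\<And>S. S \<in> Ob C \<Longrightarrow> diagonal C S \<in> MC" "\<And>X. X \<in> Ob D \<Longrightarrow> diagonal D X \<in> MD"
    and A4: "has_small_coproducts TYPE('u) D"
    and A5: "coproducts_distribute_over_pullbacks TYPE('u) D"
    and A6: "E_stable_over_relations D ED MD"
    and A7: "\<And>m. m \<in> MC \<Longrightarrow> FAr F m \<in> MD" "\<And>m. m \<in> MD \<Longrightarrow> FAr G m \<in> MC"
    and A8: "\<And>S. S \<in> Ob C \<Longrightarrow> comparison C D F S \<in> MD"
  shows
    \<comment> \<open>the assignments on objects do not depend on the representative of the relation\<close>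
    "(\<forall>S q. S \<in> Ob C \<and> is_preorder C EC MC S q \<longrightarrow>
        FOb (Ord_left C D ED MD F) (S, sub_class C MC q)
          = (FOb F S, transitive_closure D ED MD (FOb F S) (image_rel C D F S q))) \<and>
     (\<forall>X r. X \<in> Ob D \<and> is_preorder D ED MD X r \<longrightarrow>
        FOb (Ord_right C D MC G) (X, sub_class D MD r)
          = (FOb G X, sub_class C MC (image_rel D C G X r))) \<and>
     is_functor (Ord C EC MC) (Ord D ED MD) (Ord_left C D ED MD F) \<and>
     is_functor (Ord D ED MD) (Ord C EC MC) (Ord_right C D MC G) \<and>
     adjoint (Ord C EC MC) (Ord D ED MD) (Ord_left C D ED MD F) (Ord_right C D MC G)"
proof -
  \<comment> \<open>Completeness and well-poweredness over \<open>'u\<close> are consumed here, in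
    making both categories instances of \<open>relational_category\<close>.\<close>
  obtain \<phi> where "relational_adjunction C D EC MC ED MD F G \<phi>"
  proof -
    interpret C: relational_category C EC MC
      by (rule relational_category_if_complete[OF A2(1) universe ofs_C A1(1)])
    interpret D: relational_category D ED MD
      by (rule relational_category_if_complete[OF A2(2) universe ofs_D A1(2)])
    obtain \<phi> where bij: "\<And>S X. S \<in> Ob C \<Longrightarrow> X \<in> Ob D \<Longrightarrow>
        bij_betw (\<phi> S X) (Hom D (FOb F S) X) (Hom C S (FOb G X))"
      and nat: "\<And>S S' X X' s x h. S \<in> Ob C \<Longrightarrow> S' \<in> Ob C \<Longrightarrow> X \<in> Ob D \<Longrightarrow> X' \<in> Ob D \<Longrightarrow>
        s \<in> Hom C S' S \<Longrightarrow> x \<in> Hom D X X' \<Longrightarrow> h \<in> Hom D (FOb F S) X \<Longrightarrow>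
        \<phi> S' X' (x \<cdot>\<^bsub>D\<^esub> h \<cdot>\<^bsub>D\<^esub> FAr F s) = FAr G x \<cdot>\<^bsub>C\<^esub> \<phi> S X h \<cdot>\<^bsub>C\<^esub> s"
      using adj unfolding adjoint_def by blast
    have "relational_adjunction C D EC MC ED MD F G \<phi>"
      using functor_F functor_G bij nat[OF C.Hom_Ob(2) C.Hom_Ob(1) D.Hom_Ob(1) D.Hom_Ob(2)] A7 A8
      by unfold_locales blast+
    then show thesis by (rule that)
  qed
  then interpret relational_adjunction C D EC MC ED MD F G \<phi> .
  show ?thesis
    using left_ob_eq right_ob_eq is_functor_Ord_left is_functor_Ord_right adjoint_Ord
    by (auto simp: Ord_left_def Ord_right_def is_preorder_def)
qed

end
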